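(* Let $(\mathfrak M,\xi)$ be linear parameters and drifts, and let $t_0\in\mathbb R\cup\{-\infty\}$. If $t_0\in\mathbb R$, suppose that for all $m\in\mathbf M$, $p,p'\in\mathbf P$, $\alpha\in\mathbf M\cup\mathbf P$: $h^\alpha_m,h^m_p,b^m_p\in L^1$ and $h^{p'}_p,b^{p'}_p\in L^{1,n_p}_\infty$. If $t_0=-\infty$, suppose that $\operatorname{spr}(\mathrm H_{\mathfrak M})<1$, that $b^\alpha_p\in L^{1,n_p}_\infty$ for all $\alpha\in\mathbf M\cup\mathbf P$, $p\in\mathbf P$, and that $\sup_{(p,k)\in\mathcal Q}\mathbb E[|\xi^p_k|]<\infty$. Let $((N^m)_m,(W^p)_p)$, with intensities $(\lambda^m)_m$, be the linear HAR process started at $t_0$ (with empty initial condition if $t_0\in\mathbb R$), namely the unique (up to modification) non-explosive one if $t_0\in\mathbb R$, and the unique (up to modification) one with $\sup_{m,t}\mathbb E[\lambda^m_t]<\infty$ and $\sup_{(p,k)\in\mathcal Q}\mathbb E[|W^p_k|]<\infty$ if $t_0=-\infty$. Then $$W^p_k=Y^b_{p,k}(t_0)+Y^\xi_{p,k}(t_0)+\sum_{m\in\mathbf M}\int_{t_0}^{k-}Y^m_{p,k}(t_0,s)\,dN^m_s,\qquad(p,k)\in\mathcal Q,\ k\ge t_0,$$ and there is a cluster representation $$\lambda^m_t=\mathcal I^m(t_0,t)+\sum_{m'\in\mathbf M}\int_{t_0}^{t-}\mathfrak h^m_{m'}(s,t)\,dN^{m'}_s,\qquad m\in\mathbf M,\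 t\ge t_0,$$ where any $s\in N^{m_0}$ increases the intensity of $N^m$ at time $t>s$ by $$\mathfrak h^m_{m_0}(s,t)=h^m_{m_0}(t-s)+\sum_{p,p'\in\mathbf P}\int_{s+}^{t-}\int_{s+}^{k}h^m_p(t-k)\,\langle p,k\,|\,p',k'\rangle_{\mathfrak M}\,h^{p'}_{m_0}(k'-s)\,d\mathscr D^{p'}_{k'}\,d\mathscr D^p_k ,$$ and the immigrant rate is $$\mathcal I^m(t_0,t)=\mu_m+\sum_{p\in\mathbf P}\int_{t_0}^{t-}\Big[h^m_p(t-k)\big(Y^b_{p,k}(t_0)+Y^\xi_{p,k}(t_0)\big)+b^m_p(t-k)\Big]d\mathscr D^p_k .$$ Finally, if $\operatorname{spr}(\mathrm H^W_W)<1$ (which is the case when $\operatorname{spr}(\mathrm H_{\mathfrak M})<1$), then for all $m,m_0\in\mathbf M$ and $s\in\mathbb R$ $$\|\mathfrak h^m_{m_0}(s,\cdot)\|_1\le\|h^m_{m_0}\|_1+\sum_{p,p'\in\mathbf P}n_p\,\|h^m_p\|_1\,\big[(\mathrm{Id}-\mathrm H^W_W)^{-1}\big]_{p,p'}\,\|h^{p'}_{m_0}\|^\infty_{1,1}.$$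
   Context: Labels and domains. $\mathbf M$ and $\mathbf P$ are disjoint nonempty finite label sets. Each $p\in\mathbf P$ has a frequency $n_p\in\mathbb N^*=\{1,2,\dots\}$ and a phase $0\le\phi_p<1/n_p$, and $\mathcal D_p=\frac1{n_p}\mathbb Z+\phi_p$; $\mathcal Q=\{(p,k):p\in\mathbf P,\ k\in\mathcal D_p\}$. Standing assumption: $\gcd(n_p,\ p\in\mathbf P)=1$. $\mathscr D^p$ is the counting measure on $\mathcal D_p$. In integrals against $\mathscr D^p$ or point processes, $\int_a^b$ is over $[a,b]$, $\int_a^{b-}$ over $[a,b)$, $\int_{a+}^{b}$ over $(a,b]$, $\int_{a+}^{b-}$ over $(a,b)$ ($a=-\infty$ allowed). Norms. Functions on $(0,\infty)$ are extended by $0$ to $\mathbb R$. $\|f\|_1$ is the $L^1$ norm, $\|\mathfrak h(s,\cdot)\|_1=\int_s^\infty\mathfrak h(s,t)\,dt$; for $\alpha>0$, $\|f\|^\infty_{1,\alpha}=\sup_{x\in\mathbb R}\sum_{k\in\mathbb Z}|f(x+k/\alpha)|$, and $f\in L^{1,\alpha}_\infty$ means $\|f\|^\infty_{1,\alpha}<\infty$. Linear parameters and drifts. $\mathfrak M$ consists of constants $\mu_m\ge0$ ($m\in\mathbf M$) and (measurable) functions $h^\alpha_m,h^\alpha_p,b^\alpha_p:(0,\infty)\to[0,\infty)$ for $\alpha\in\mathbf M\cup\mathbf P$, $m\in\mathbf M$, $p\in\mathbf P$. (These are HAR parameters with link functions $\Phi^m=\mu_m+\mathrm{id}$, $\Phi^p=\mathrm{id}$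 and $J^\alpha_p(s,w)=h^\alpha_p(s)w+b^\alpha_p(s)$.) Random drifts $\xi=(\xi^p_k)_{(p,k)\in\mathcal Q}$ are independent real random variables with $\xi^p_k\sim\xi^p_{k+n}$ in law for all $n\in\mathbb Z$; in the linear class, $\xi^p_k\ge0$. Matrices. $\mathrm H_{\mathfrak M}=\begin{pmatrix}\mathrm H^N_N&\mathrm H^N_W\\ \mathrm H^W_N&\mathrm H^W_W\end{pmatrix}$ with (all link Lipschitz constants being $1$) $\mathrm H^N_N=(\|h^m_{m'}\|_1)_{m,m'}$, $\mathrm H^N_W=(\|h^m_p\|^\infty_{1,n_p})_{m,p}$, $\mathrm H^W_N=(\|h^p_m\|_1)_{p,m}$, $\mathrm H^W_W=(\|h^p_{p'}\|^\infty_{1,n_{p'}})_{p,p'}$. $\operatorname{spr}$ is the spectral radius; $\operatorname{spr}<1$ includes that all entries are finite. Probabilistic setting. $(\pi^m)_{m\in\mathbf M}$ are independent Poisson random measures on $\mathbb R\times[0,\infty)$ with intensity $dt\,dx$, with distinct time coordinates of atoms, independent of $\xi$; $\mathcal F_t=\sigma\big(\pi^m\cap((-\infty,t]\times[0,\infty)),\,m\in\mathbf M;\ \xi^p_k,\,(p,k)\in\mathcal Q,\,k\le t\big)$. Linear HAR process started at $t_0\in\mathbb R\cup\{-\infty\}$ (empty initial condition when $t_0\in\mathbb R$: no points and no values before $t_0$): $X=((N^m)_m,(W^p)_p)$ adapted to $(\mathcal F_t)_t$, with $(N^m)_m$ pairwise disjoint point processes and $W^p=(W^p_k)_{k\in\mathcal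 D_p,k\ge t_0}$, such that, $\mathbb P\otimes dt$-a.e. for $t\ge t_0$, $$\lambda^m_t=\mu_m+\sum_{m'}\int_{t_0}^{t-}h^m_{m'}(t-s)\,dN^{m'}_s+\sum_p\int_{t_0}^{t-}\big(h^m_p(t-k)W^p_k+b^m_p(t-k)\big)d\mathscr D^p_k,$$ almost surely $N^m(C)=\int_{C\times[0,\infty)}\mathbf 1_{x\le\lambda^m_s}\,d\pi^m(s,x)$ for all $C\subset[t_0,\infty)$, and almost surely for all $(p,k)\in\mathcal Q$, $k\ge t_0$, $$W^p_k=\xi^p_k+\sum_m\int_{t_0}^{k-}h^p_m(k-s)\,dN^m_s+\sum_{p'}\int_{t_0}^{k-}\big(h^p_{p'}(k-k')W^{p'}_{k'}+b^p_{p'}(k-k')\big)d\mathscr D^{p'}_{k'}.$$ Non-explosive: for every bounded $B$, $\sum_mN^m(B)+\sum_p\int_B|W^p_k|d\mathscr D^p_k<\infty$ (a.s.). Modification: a.s. equality of all $N^m$ and all $W^p_k$. Equalities for $W$ are almost sure; those for $\lambda$ hold $\mathbb P\otimes dt$-a.e. (the intensity being defined only up to such null sets). Coefficients. $\langle p,k\,|\,p',k'\rangle_{\mathfrak M}$, for $(p,k),(p',k')\in\mathcal Q$ with $k'\le k$, is the family determined by $\langle p,k\,|\,p',k\rangle_{\mathfrak M}=\mathbf 1_{p=p'}$ and, for $k'<k$, $$\langle p,k\,|\,p',k'\rangle_{\mathfrak M}=\sum_{p''\in\mathbf P}\int_{k'}^{k-}h^p_{p''}(k-k'')\,\langle p'',k''\,|\,p',k'\rangle_{\mathfrak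 M}\,d\mathscr D^{p''}_{k''}.$$ Quantities $Y$. For $(p,k)\in\mathcal Q$, $k\ge t_0$, $t_0\le s\le k$: $Y^b_{p,k}(t_0)=\sum_{p'}\int_{t_0}^k\langle p,k|p',k'\rangle_{\mathfrak M}\big[\sum_{p''}\int_{t_0}^{k'-}b^{p'}_{p''}(k'-k'')\,d\mathscr D^{p''}_{k''}\big]d\mathscr D^{p'}_{k'}$; $Y^\xi_{p,k}(t_0)=\sum_{p'}\int_{t_0}^k\langle p,k|p',k'\rangle_{\mathfrak M}\,\xi^{p'}_{k'}\,d\mathscr D^{p'}_{k'}$; $Y^m_{p,k}(t_0,s)=\sum_{p'}\int_{t_0}^k\langle p,k|p',k'\rangle_{\mathfrak M}\,h^{p'}_m(k'-s)\,d\mathscr D^{p'}_{k'}$. *)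

theory Defs
  imports "HOL-Probability.Probability"
begin

text \<open>
  The finite nonempty label sets M and P are finite types 'm and 'p; their disjoint union is the
  sum type, so that \<open>hfun P \<alpha> \<beta>\<close> is \<open>h\<^sup>\<alpha>\<^sub>\<beta>\<close> and \<open>bfun P \<alpha> p\<close> is \<open>b\<^sup>\<alpha>\<^sub>p\<close>, with upper index first.
\<close>

record ('m, 'p) har_params =
  freq :: "'p \<Rightarrow> nat"
  phase :: "'p \<Rightarrow> real"
  base :: "'m \<Rightarrow> real"
  hfun :: "'m + 'p \<Rightarrow> 'm + 'p \<Rightarrow> real \<Rightarrow> real"
  bfun :: "'m + 'p \<Rightarrow> 'p \<Rightarrow> real \<Rightarrow> real"

definition grid :: "('m, 'p) har_params \<Rightarrow> 'p \<Rightarrow> real set" where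
  "grid P p = range (\<lambda>j::int. real_of_int j / real (freq P p) + phase P p)"

definition grid_points :: "('m, 'p) har_params \<Rightarrow> ('p \<times> real) set" where
  "grid_points P = {(p, k). k \<in> grid P p}"

text \<open>Functions on \<open>(0,\<infinity>)\<close> are represented by their extension by 0 to the whole line.\<close>

definition kernel :: "(real \<Rightarrow> real) \<Rightarrow> bool" where
  "kernel f \<longleftrightarrow> f \<in> borel_measurable borel \<and> (\<forall>x. 0 \<le> f x) \<and> (\<forall>x\<le>0. f x = 0)"

definition linear_params :: "('m, 'p) har_params \<Rightarrow> bool" where
  "linear_params P \<longleftrightarrow>
     (\<forall>p. 1 \<le> freq P p \<and> 0 \<le> phase P p \<and> phase P p < 1 / real (freq P p)) \<and>
     Gcd (range (freq P)) = 1 \<and>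
     (\<forall>m. 0 \<le> base P m) \<and>
     (\<forall>\<alpha> \<beta>. kernel (hfun P \<alpha> \<beta>)) \<and>
     (\<forall>\<alpha> p. kernel (bfun P \<alpha> p))"


subsection \<open>Norms and matrices\<close>

definition l1_norm :: "(real \<Rightarrow> real) \<Rightarrow> ennreal" where
  "l1_norm f = (\<integral>\<^sup>+ x. ennreal \<bar>f x\<bar> \<partial>lborel)"

definition amalgam_norm :: "real \<Rightarrow> (real \<Rightarrow> real) \<Rightarrow> ennreal" where
  "amalgam_norm a f =
     (SUP x. \<integral>\<^sup>+ k. ennreal \<bar>f (x + real_of_int k / a)\<bar> \<partial>count_space (UNIV :: int set))"

text \<open>The entries of \<open>H\<close> may be infinite; the norm used in an entry depends on its column only.\<close>

definition H_full :: "('m, 'p) har_params \<Rightarrow> 'm + 'p \<Rightarrow> 'm + 'p \<Rightarrow> ennreal" where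
  "H_full P \<alpha> \<beta> = (case \<beta> of
       Inl m \<Rightarrow> l1_norm (hfun P \<alpha> \<beta>)
     | Inr p \<Rightarrow> amalgam_norm (real (freq P p)) (hfun P \<alpha> \<beta>))"

definition H_WW :: "('m, 'p) har_params \<Rightarrow> 'p \<Rightarrow> 'p \<Rightarrow> ennreal" where
  "H_WW P p p' = H_full P (Inr p) (Inr p')"

definition real_matrix :: "('n::finite \<Rightarrow> 'n \<Rightarrow> ennreal) \<Rightarrow> real ^ 'n ^ 'n" where
  "real_matrix A = (\<chi> i j. enn2real (A i j))"

definition spr :: "real ^ 'n ^ 'n \<Rightarrow> real" where
  "spr A = Sup {cmod z | z. \<exists>v :: complex ^ 'n. v \<noteq> 0 \<and>
                  (\<chi> i j. complex_of_real (A $ i $ j)) *v v = z *s v}"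

definition spr_less_one :: "('n::finite \<Rightarrow> 'n \<Rightarrow> ennreal) \<Rightarrow> bool" where
  "spr_less_one A \<longleftrightarrow> (\<forall>i j. A i j < \<infinity>) \<and> spr (real_matrix A) < 1"


subsection \<open>Coefficients\<close>

lemma finite_grid_Int: "finite (grid P p \<inter> {a..<b})"
proof (cases "freq P p = 0")
  case True
  then show ?thesis by (auto simp: grid_def)
next
  case False
  define n where "n = real (freq P p)"
  have n: "n > 0" using False by (simp add: n_def)
  have "grid P p \<inter> {a..<b} \<subseteq>
     (\<lambda>j::int. real_of_int j / n + phase P p) `
       {\<lfloor>(a - phase P p) * n\<rfloor> .. \<lceil>(b - phase P p) * n\<rceil>}"
  proof
    fix x assume "x \<in> grid P p \<inter> {a..<b}"
    then obtain j :: int where j: "x = real_of_int j / n + phase P p" "a \<le> x" "x < b"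
      by (auto simp: grid_def n_def)
    have "(a - phase P p) * n \<le> j" "j \<le> (b - phase P p) * n"
      using mult_right_mono[of a x n] mult_right_mono[of x b n] j n
      by (simp_all add: algebra_simps)
    then have "\<lfloor>(a - phase P p) * n\<rfloor> \<le> j" "j \<le> \<lceil>(b - phase P p) * n\<rceil>"
      by linarith+
    then show "x \<in> (\<lambda>j::int. real_of_int j / n + phase P p) `
       {\<lfloor>(a - phase P p) * n\<rfloor> .. \<lceil>(b - phase P p) * n\<rceil>}"
      using j by auto
  qed
  then show ?thesis by (rule finite_subset) simp
qed

text \<open>
  \<open>coef P p k p' k'\<close> is \<open>\<langle>p, k | p', k'\<rangle>\<close>. The inner sums range over finite sets, and the value for
  \<open>k < k'\<close> is irrelevant.
\<close>

function coef :: "('m, 'p::finite) har_params \<Rightarrow> 'p \<Rightarrow> real \<Rightarrow> 'p \<Rightarrow> real \<Rightarrow> real" where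
  "coef P p k p' k' =
     (if k < k' then 0
      else if k = k' then (if p = p' then 1 else 0)
      else (\<Sum>p''\<in>UNIV. \<Sum>k''\<in>grid P p'' \<inter> {k'..<k}.
              hfun P (Inr p) (Inr p'') (k - k'') * coef P p'' k'' p' k'))"
  by pat_completeness auto
termination
proof (relation "Wellfounded.measure (\<lambda>(P, p, k, p', k'). card ((\<Union>q. grid P q) \<inter> {k'..<k}))", goal_cases)
  case 1
  show ?case by simp
next
  case (2 P p k p' k' p'' k'')
  have "finite ((\<Union>q. grid P q) \<inter> {k'..<k})"
    using finite_grid_Int[of P _ k' k] by (simp add: UN_extend_simps del: UN_simps)
  moreover have "(\<Union>q. grid P q) \<inter> {k'..<k''} \<subset> (\<Union>q. grid P q) \<inter> {k'..<k}"
    using 2 by fastforce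
  ultimately show ?case by (auto intro: psubset_card_mono)
qed

declare coef.simps [simp del]


subsection \<open>Driving noise\<close>

text \<open>
  Point processes are random sets of points; \<open>npts S\<close> is the number of points of \<open>S\<close>, in
  \<open>[0,\<infinity>]\<close>, and an integral against the point process \<open>S\<close> is an integral against \<open>count_space S\<close>.
\<close>

definition npts :: "'b set \<Rightarrow> ennreal" where
  "npts S = emeasure (count_space UNIV) S"

definition poisson_random_measure :: "'a measure \<Rightarrow> ('a \<Rightarrow> (real \<times> real) set) \<Rightarrow> bool" where
  "poisson_random_measure M \<pi> \<longleftrightarrow>
     (\<forall>\<omega>\<in>space M. \<pi> \<omega> \<subseteq> UNIV \<times> {0..}) \<and>
     (\<forall>A\<in>sets borel. (\<lambda>\<omega>. npts (\<pi> \<omega> \<inter> A)) \<in> borel_measurable M) \<and>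
     (\<forall>A\<in>sets borel. A \<subseteq> UNIV \<times> {0..} \<longrightarrow> emeasure lborel A < \<infinity> \<longrightarrow>
        (\<forall>j. measure M {\<omega> \<in> space M. npts (\<pi> \<omega> \<inter> A) = of_nat j} =
              measure lborel A ^ j / fact j * exp (- measure lborel A))) \<and>
     (\<forall>A :: nat \<Rightarrow> (real \<times> real) set. range A \<subseteq> sets borel \<longrightarrow> disjoint_family A \<longrightarrow>
        prob_space.indep_vars M (\<lambda>_. borel) (\<lambda>i \<omega>. npts (\<pi> \<omega> \<inter> A i)) UNIV)"

definition prm_events ::
    "'a measure \<Rightarrow> ('a \<Rightarrow> (real \<times> real) set) \<Rightarrow> (real \<times> real) set \<Rightarrow> 'a set set" where
  "prm_events M \<pi> S =
     {(\<lambda>\<omega>. npts (\<pi> \<omega> \<inter> A)) -` B \<inter> space M | A B. A \<in> sets borel \<and> A \<subseteq> S \<and> B \<in> sets borel}"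

definition rv_events :: "'a measure \<Rightarrow> ('a \<Rightarrow> real) \<Rightarrow> 'a set set" where
  "rv_events M X = {X -` B \<inter> space M | B. B \<in> sets borel}"

definition linear_drifts ::
    "'a measure \<Rightarrow> ('m, 'p) har_params \<Rightarrow> ('p \<Rightarrow> real \<Rightarrow> 'a \<Rightarrow> real) \<Rightarrow> bool" where
  "linear_drifts M P \<xi> \<longleftrightarrow>
     prob_space.indep_vars M (\<lambda>_. borel) (\<lambda>(p, k). \<xi> p k) (grid_points P) \<and>
     (\<forall>(p, k)\<in>grid_points P. \<forall>n::int.
        distr M borel (\<xi> p k) = distr M borel (\<xi> p (k + real_of_int n))) \<and>
     (\<forall>(p, k)\<in>grid_points P. AE \<omega> in M. 0 \<le> \<xi> p k \<omega>)"

text \<open>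
  The second condition says that no two atoms, of the same or of different \<open>\<pi> m\<close>, share their
  time coordinate; the third that the \<open>\<pi> m\<close> and the whole family \<open>\<xi>\<close> are independent.
\<close>

definition driving_noise ::
    "'a measure \<Rightarrow> ('m, 'p) har_params \<Rightarrow> ('m \<Rightarrow> 'a \<Rightarrow> (real \<times> real) set) \<Rightarrow>
     ('p \<Rightarrow> real \<Rightarrow> 'a \<Rightarrow> real) \<Rightarrow> bool" where
  "driving_noise M P \<pi> \<xi> \<longleftrightarrow>
     (\<forall>m. poisson_random_measure M (\<pi> m)) \<and>
     (AE \<omega> in M. inj_on (\<lambda>(m, z). fst z) (SIGMA m:UNIV. \<pi> m \<omega>)) \<and>
     prob_space.indep_sets M
       (\<lambda>i. case i of
           None \<Rightarrow> sigma_sets (space M) (\<Union>(p, k)\<in>grid_points P. rv_events M (\<xi> p k))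
         | Some m \<Rightarrow> sigma_sets (space M) (prm_events M (\<pi> m) UNIV))
       UNIV"

definition history ::
    "'a measure \<Rightarrow> ('m, 'p) har_params \<Rightarrow> ('m \<Rightarrow> 'a \<Rightarrow> (real \<times> real) set) \<Rightarrow>
     ('p \<Rightarrow> real \<Rightarrow> 'a \<Rightarrow> real) \<Rightarrow> real \<Rightarrow> 'a measure" where
  "history M P \<pi> \<xi> t = sigma (space M)
     ((\<Union>m. prm_events M (\<pi> m) ({..t} \<times> {0..})) \<union>
      (\<Union>(p, k)\<in>{(p, k). (p, k) \<in> grid_points P \<and> k \<le> t}. rv_events M (\<xi> p k)))"


subsection \<open>Linear HAR processes\<close>

text \<open>The starting time \<open>t0\<close> is an extended real, real or \<open>-\<infinity>\<close>.\<close>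

definition ico :: "ereal \<Rightarrow> real \<Rightarrow> real set" where
  "ico t0 t = {s. t0 \<le> ereal s \<and> s < t}"

definition icc :: "ereal \<Rightarrow> real \<Rightarrow> real set" where
  "icc t0 t = {s. t0 \<le> ereal s \<and> s \<le> t}"

text \<open>
  \<open>har_input P t0 N W \<alpha> t\<close> is what a realization of the process contributes at time \<open>t\<close> to the
  intensity of type \<open>m\<close> (\<open>\<alpha> = Inl m\<close>) or to the value of type \<open>p\<close> (\<open>\<alpha> = Inr p\<close>). Since the
  integral of a non-integrable function is 0 by convention, integrability is required separately.
\<close>

definition har_input ::
    "('m::finite, 'p::finite) har_params \<Rightarrow> ereal \<Rightarrow> ('m \<Rightarrow> real set) \<Rightarrow> ('p \<Rightarrow> real \<Rightarrow> real) \<Rightarrow>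
     'm + 'p \<Rightarrow> real \<Rightarrow> real" where
  "har_input P t0 N W \<alpha> t =
     (\<Sum>m\<in>UNIV. LINT s:ico t0 t|count_space (N m). hfun P \<alpha> (Inl m) (t - s)) +
     (\<Sum>p\<in>UNIV. LINT k:ico t0 t|count_space (grid P p).
        (hfun P \<alpha> (Inr p) (t - k) * W p k + bfun P \<alpha> p (t - k)))"

definition har_input_converges ::
    "('m, 'p) har_params \<Rightarrow> ereal \<Rightarrow> ('m \<Rightarrow> real set) \<Rightarrow> ('p \<Rightarrow> real \<Rightarrow> real) \<Rightarrow>
     'm + 'p \<Rightarrow> real \<Rightarrow> bool" where
  "har_input_converges P t0 N W \<alpha> t \<longleftrightarrow>
     (\<forall>m. set_integrable (count_space (N m)) (ico t0 t) (\<lambda>s. hfun P \<alpha> (Inl m) (t - s))) \<and>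
     (\<forall>p. set_integrable (count_space (grid P p)) (ico t0 t)
        (\<lambda>k. hfun P \<alpha> (Inr p) (t - k) * W p k + bfun P \<alpha> p (t - k)))"

text \<open>
  \<open>N m \<omega>\<close> is the set of points of type \<open>m\<close>, \<open>W p k \<omega>\<close> the value of type \<open>p\<close> at time \<open>k\<close> (only
  \<open>k \<in> grid P p\<close> with \<open>t0 \<le> k\<close> matters), and \<open>lam m t \<omega>\<close> a version of the intensity.
\<close>

definition linear_har_process ::
    "'a measure \<Rightarrow> ('m::finite, 'p::finite) har_params \<Rightarrow> ('m \<Rightarrow> 'a \<Rightarrow> (real \<times> real) set) \<Rightarrow>
     ('p \<Rightarrow> real \<Rightarrow> 'a \<Rightarrow> real) \<Rightarrow> ereal \<Rightarrow>
     ('m \<Rightarrow> 'a \<Rightarrow> real set) \<Rightarrow> ('p \<Rightarrow> real \<Rightarrow> 'a \<Rightarrow> real) \<Rightarrow> ('m \<Rightarrow> real \<Rightarrow> 'a \<Rightarrow> real) \<Rightarrow> bool"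
  where
  "linear_har_process M P \<pi> \<xi> t0 N W lam \<longleftrightarrow>
     (\<forall>m. (\<lambda>(\<omega>, t). lam m t \<omega>) \<in> borel_measurable (M \<Otimes>\<^sub>M lborel)) \<and>
     (\<forall>m t. \<forall>\<omega>\<in>space M. 0 \<le> lam m t \<omega>) \<and>
     (\<forall>m t. \<forall>C\<in>sets borel. C \<subseteq> {..t} \<longrightarrow>
        (\<lambda>\<omega>. npts (N m \<omega> \<inter> C)) \<in> borel_measurable (history M P \<pi> \<xi> t)) \<and>
     (\<forall>(p, k)\<in>grid_points P. t0 \<le> ereal k \<longrightarrow>
        W p k \<in> borel_measurable (history M P \<pi> \<xi> k)) \<and>
     (AE \<omega> in M. disjoint_family (\<lambda>m. N m \<omega>)) \<and>
     (AE \<omega> in M. \<forall>m. \<forall>s\<in>N m \<omega>. t0 \<le> ereal s) \<and>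
     (\<forall>m. AE (\<omega>, t) in M \<Otimes>\<^sub>M lborel. t0 \<le> ereal t \<longrightarrow>
        har_input_converges P t0 (\<lambda>m'. N m' \<omega>) (\<lambda>p k. W p k \<omega>) (Inl m) t \<and>
        lam m t \<omega> = base P m + har_input P t0 (\<lambda>m'. N m' \<omega>) (\<lambda>p k. W p k \<omega>) (Inl m) t) \<and>
     (AE \<omega> in M. \<forall>m. \<forall>C\<in>sets borel. (\<forall>s\<in>C. t0 \<le> ereal s) \<longrightarrow>
        npts (N m \<omega> \<inter> C) =
          (\<integral>\<^sup>+ z\<in>C \<times> {0..}. (if snd z \<le> lam m (fst z) \<omega> then 1 else 0) \<partial>count_space (\<pi> m \<omega>))) \<and>
     (AE \<omega> in M. \<forall>(p, k)\<in>grid_points P. t0 \<le> ereal k \<longrightarrow>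
        har_input_converges P t0 (\<lambda>m. N m \<omega>) (\<lambda>p k. W p k \<omega>) (Inr p) k \<and>
        W p k \<omega> = \<xi> p k \<omega> + har_input P t0 (\<lambda>m. N m \<omega>) (\<lambda>p k. W p k \<omega>) (Inr p) k)"

definition non_explosive ::
    "'a measure \<Rightarrow> ('m::finite, 'p::finite) har_params \<Rightarrow> ereal \<Rightarrow> ('m \<Rightarrow> 'a \<Rightarrow> real set) \<Rightarrow>
     ('p \<Rightarrow> real \<Rightarrow> 'a \<Rightarrow> real) \<Rightarrow> bool" where
  "non_explosive M P t0 N W \<longleftrightarrow>
     (\<forall>B. bounded B \<longrightarrow> (AE \<omega> in M.
        (\<Sum>m\<in>UNIV. npts (N m \<omega> \<inter> B)) +
        (\<Sum>p\<in>UNIV. \<integral>\<^sup>+ k\<in>{k \<in> B. t0 \<le> ereal k}. ennreal \<bar>W p k \<omega>\<bar> \<partial>count_space (grid P p))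
        < \<infinity>))"

definition bounded_means ::
    "'a measure \<Rightarrow> ('m, 'p) har_params \<Rightarrow> ('p \<Rightarrow> real \<Rightarrow> 'a \<Rightarrow> real) \<Rightarrow>
     ('m \<Rightarrow> real \<Rightarrow> 'a \<Rightarrow> real) \<Rightarrow> bool" where
  "bounded_means M P W lam \<longleftrightarrow>
     (SUP (m, t). \<integral>\<^sup>+ \<omega>. ennreal (lam m t \<omega>) \<partial>M) < \<infinity> \<and>
     (SUP (p, k)\<in>grid_points P. \<integral>\<^sup>+ \<omega>. ennreal \<bar>W p k \<omega>\<bar> \<partial>M) < \<infinity>"


subsection \<open>Cluster representation\<close>

text \<open>
  All quantities below are nonnegative and take values in \<open>[0,\<infinity>]\<close>. The argument \<open>x\<close> stands for a
  realization of the drifts.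
\<close>

definition Y_b :: "('m, 'p::finite) har_params \<Rightarrow> ereal \<Rightarrow> 'p \<Rightarrow> real \<Rightarrow> ennreal" where
  "Y_b P t0 p k =
     (\<Sum>p'\<in>UNIV. \<integral>\<^sup>+ k'\<in>icc t0 k. ennreal (coef P p k p' k') *
        (\<Sum>p''\<in>UNIV. \<integral>\<^sup>+ k''\<in>ico t0 k'. ennreal (bfun P (Inr p') p'' (k' - k''))
           \<partial>count_space (grid P p''))
        \<partial>count_space (grid P p'))"

definition Y_xi ::
    "('m, 'p::finite) har_params \<Rightarrow> ('p \<Rightarrow> real \<Rightarrow> real) \<Rightarrow> ereal \<Rightarrow> 'p \<Rightarrow> real \<Rightarrow> ennreal" where
  "Y_xi P x t0 p k =
     (\<Sum>p'\<in>UNIV. \<integral>\<^sup>+ k'\<in>icc t0 k. ennreal (coef P p k p' k') * ennreal (x p' k')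
        \<partial>count_space (grid P p'))"

definition Y_pt ::
    "('m, 'p::finite) har_params \<Rightarrow> 'm \<Rightarrow> ereal \<Rightarrow> real \<Rightarrow> 'p \<Rightarrow> real \<Rightarrow> ennreal" where
  "Y_pt P m t0 s p k =
     (\<Sum>p'\<in>UNIV. \<integral>\<^sup>+ k'\<in>icc t0 k. ennreal (coef P p k p' k') *
        ennreal (hfun P (Inr p') (Inl m) (k' - s)) \<partial>count_space (grid P p'))"

definition cluster_kernel ::
    "('m, 'p::finite) har_params \<Rightarrow> 'm \<Rightarrow> 'm \<Rightarrow> real \<Rightarrow> real \<Rightarrow> ennreal" where
  "cluster_kernel P m m0 s t =
     ennreal (hfun P (Inl m) (Inl m0) (t - s)) +
     (\<Sum>p\<in>UNIV. \<Sum>p'\<in>UNIV. \<integral>\<^sup>+ k\<in>{s<..<t}.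
        (\<integral>\<^sup>+ k'\<in>{s<..k}.
           ennreal (hfun P (Inl m) (Inr p) (t - k)) * ennreal (coef P p k p' k') *
           ennreal (hfun P (Inr p') (Inl m0) (k' - s)) \<partial>count_space (grid P p'))
        \<partial>count_space (grid P p))"

definition immigrant_rate ::
    "('m, 'p::finite) har_params \<Rightarrow> ('p \<Rightarrow> real \<Rightarrow> real) \<Rightarrow> 'm \<Rightarrow> ereal \<Rightarrow> real \<Rightarrow> ennreal" where
  "immigrant_rate P x m t0 t =
     ennreal (base P m) +
     (\<Sum>p\<in>UNIV. \<integral>\<^sup>+ k\<in>ico t0 t.
        (ennreal (hfun P (Inl m) (Inr p) (t - k)) * (Y_b P t0 p k + Y_xi P x t0 p k) +
         ennreal (bfun P (Inl m) p (t - k)))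
        \<partial>count_space (grid P p))"

end

theory Submission
  imports Defs
begin

text \<open>
  The values \<open>W\<close> solve a linear Volterra recursion on the grids whose resolvent is the family
  of coefficients. Restarting it at a real time \<open>a\<close>, after splitting off the contribution of the
  grid values before \<open>a\<close>, involves finite sums only and is solved by induction along the grid. For
  \<open>t0 = -\<infinity>\<close> one lets \<open>a\<close> tend to \<open>-\<infinity>\<close>: the coefficients issued from a grid point are summable,
  with sum bounded by the entries of \<open>(Id - H\<^sub>W\<^sub>W)\<^sup>-\<^sup>1\<close>, so that the contribution of the past tends to 0 in mean,
  and Fatou's lemma makes its lower limit vanish almost surely. Everything else is the interchange of
  sums of nonnegative terms.

  That \<open>spr A < 1\<close> makes \<open>(Id - A)\<^sup>-\<^sup>1\<close> exist and be nonnegative is obtained from Brouwer's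
  fixed point theorem instead of the Neumann series: a nonzero \<open>x \<ge> 0\<close> with \<open>A x \<ge> x\<close> would
  produce an eigenvalue at least 1.
\<close>

section \<open>Nonnegative matrices\<close>

text \<open>The truncated solutions started at \<open>- real n\<close> increase with
  \<open>n\<close>, because the coefficients and the free term are nonnegative. This is why a
  vanishing lower limit of the past contribution suffices, although convergence in mean by itself
  controls only subsequences almost surely. The sign of \<open>W\<close> is not given but comes out
  of the argument; until then the past is bounded through absolute values, and summability of the
  \<open>b\<close> part is supplied separately. Once the sign is known all sums live in
  \<open>ennreal\<close>, and the final equalities with real numbers also assert finiteness.

  \<open>spr\<close> is a supremum over complex eigenvalues, which says nothing directly about
  powers of the matrix, whereas the fixed point argument only has to produce one real eigenvalue.
  Restricting Brouwer's map to the cone of vectors with \<open>x \<le> A x\<close> makes that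
  eigenvalue at least 1.

  In the last bound, the factor \<open>n_p\<close> and the norm with period 1 reflect that the
  integers are exactly the common periods of the grids, the frequencies having gcd 1.\<close>

lemma simplex_vec_props:
  fixes S :: "(real ^ 'n::finite) set"
  defines "S \<equiv> {x. (\<forall>i. 0 \<le> x $ i) \<and> (\<Sum>i\<in>UNIV. x $ i) = 1}"
  shows "compact S" "convex S" "S \<noteq> {}"
proof -
  have "S = (\<Inter>i. {x. 0 \<le> x $ i}) \<inter> {x. (\<Sum>i\<in>UNIV. x $ i) = 1}"
    by (auto simp: S_def)
  moreover have "closed {x :: real ^ 'n. 0 \<le> x $ i}" for i
    by (intro closed_Collect_le continuous_intros)
  moreover have "closed {x :: real ^ 'n. (\<Sum>i\<in>UNIV. x $ i) = 1}"
    by (intro closed_Collect_eq continuous_intros)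
  ultimately have "closed S"
    by auto
  moreover have "norm x \<le> 1" if "x \<in> S" for x
    using norm_le_l1_cart[of x] that by (simp add: S_def)
  then have "bounded S"
    by (auto simp: bounded_iff)
  ultimately show "compact S"
    by (simp add: compact_eq_bounded_closed)
  show "convex S"
    unfolding convex_def S_def
    by (auto simp: sum.distrib simp flip: sum_distrib_left)
  have "axis (undefined :: 'n) 1 \<in> S"
    by (auto simp: S_def axis_def)
  then show "S \<noteq> {}"
    by blast
qed

text \<open>Brouwer's theorem for \<open>x \<mapsto> (x + A x) / (1 + \<Sum>\<^sub>i (A x)\<^sub>i)\<close> on the part of the cone \<open>K\<close> in the simplex.\<close>

lemma nonneg_matrix_eigenvalue_on_cone:
  fixes A :: "real ^ 'n ^ 'n" and K :: "(real ^ 'n) set"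
  assumes A: "\<And>i j. 0 \<le> A $ i $ j"
    and K: "closed K" "convex K" "\<And>x c. x \<in> K \<Longrightarrow> 0 \<le> c \<Longrightarrow> c *\<^sub>R x \<in> K"
    and inv: "\<And>x. x \<in> K \<Longrightarrow> (\<forall>i. 0 \<le> x $ i) \<Longrightarrow> x + A *v x \<in> K"
    and x0: "x0 \<in> K" "\<And>i. 0 \<le> x0 $ i" "x0 \<noteq> 0"
  obtains x l where "x \<in> K" "\<And>i. 0 \<le> x $ i" "x \<noteq> 0" "A *v x = l *\<^sub>R x" "0 \<le> l"
proof -
  define S where "S = {x :: real ^ 'n. (\<forall>i. 0 \<le> x $ i) \<and> (\<Sum>i\<in>UNIV. x $ i) = 1}"
  define \<sigma> where "\<sigma> x = (\<Sum>i\<in>UNIV. (A *v x) $ i)" for x :: "real ^ 'n"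
  \<comment> \<open>Adding \<open>x\<close> to \<open>A *v x\<close> keeps the coordinate sum at
    least 1 on the simplex, also where \<open>A *v x\<close> vanishes.\<close>
  define f where "f x = (1 / (1 + \<sigma> x)) *\<^sub>R (x + A *v x)" for x
  have Ax: "0 \<le> (A *v x) $ i" if "\<And>i. 0 \<le> x $ i" for x i
    using that A by (auto simp: matrix_vector_mult_def intro!: sum_nonneg)
  have \<sigma>: "0 \<le> \<sigma> x" if "x \<in> S" for x
    using that Ax by (auto simp: \<sigma>_def S_def intro!: sum_nonneg)
  have S: "compact S" "convex S"
    using simplex_vec_props unfolding S_def by auto
  obtain i0 where "x0 $ i0 \<noteq> 0"
    using x0(3) by (auto simp: vec_eq_iff)
  then have s0: "0 < (\<Sum>i\<in>UNIV. x0 $ i)"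
    using x0(2) by (intro sum_pos2[of UNIV i0]) (auto simp: less_le)
  have "(1 / (\<Sum>i\<in>UNIV. x0 $ i)) *\<^sub>R x0 \<in> K \<inter> S"
    using x0 s0 K(3)[OF x0(1), of "1 / (\<Sum>i\<in>UNIV. x0 $ i)"]
    by (auto simp: S_def simp flip: sum_divide_distrib)
  then have ne: "K \<inter> S \<noteq> {}"
    by blast
  have lin: "continuous_on T (\<lambda>x. A *v x)" for T
    by (intro linear_continuous_on matrix_vector_mul_bounded_linear)
  have "continuous_on (K \<inter> S) \<sigma>"
    unfolding \<sigma>_def by (intro continuous_intros lin)
  moreover have "1 + \<sigma> x \<noteq> 0" if "x \<in> S" for x
    using \<sigma>[OF that] by simp
  ultimately have "continuous_on (K \<inter> S) f"
    unfolding f_def by (intro continuous_intros lin) auto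
  moreover have "f \<in> K \<inter> S \<rightarrow> K \<inter> S"
  proof
    fix x assume x: "x \<in> K \<inter> S"
    then have nn: "\<And>i. 0 \<le> x $ i" and s: "(\<Sum>i\<in>UNIV. x $ i) = 1" and sx: "0 \<le> \<sigma> x"
      using \<sigma> by (auto simp: S_def)
    have "f x \<in> K"
      unfolding f_def using x nn sx by (intro K(3) inv) auto
    moreover have "f x \<in> S"
      using nn Ax[OF nn] sx s
      by (auto simp: S_def f_def \<sigma>_def sum.distrib simp flip: sum_divide_distrib)
    ultimately show "f x \<in> K \<inter> S" by simp
  qed
  ultimately obtain x where x: "x \<in> K \<inter> S" "f x = x"
    by (rule brouwer[OF closed_Int_compact[OF K(1) S(1)] convex_Int[OF K(2) S(2)] ne])
  have "(1 + \<sigma> x) *\<^sub>R f x = x + A *v x"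
    using \<sigma>[of x] x(1) by (simp add: f_def)
  then have "A *v x = (1 + \<sigma> x) *\<^sub>R x - x"
    by (simp add: x(2))
  then have "A *v x = \<sigma> x *\<^sub>R x"
    by (simp add: scaleR_left_distrib)
  moreover have "x \<noteq> 0"
    using x by (auto simp: S_def)
  ultimately show thesis
    using that x \<sigma> by (auto simp: S_def)
qed

section \<open>Complex eigenvalues and the spectral radius\<close>

definition complex_eigenvalue :: "real ^ 'n ^ 'n \<Rightarrow> complex \<Rightarrow> bool" where
  "complex_eigenvalue A z \<longleftrightarrow>
     (\<exists>v :: complex ^ 'n. v \<noteq> 0 \<and> (\<chi> i j. complex_of_real (A $ i $ j)) *v v = z *s v)"

lemma spr_eq: "spr A = Sup (cmod ` Collect (complex_eigenvalue A))"
  unfolding spr_def complex_eigenvalue_def by (simp add: setcompr_eq_image)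

lemma complex_eigenvalue_of_real:
  fixes A :: "real ^ 'n ^ 'n"
  assumes "A *v x = l *\<^sub>R x" "x \<noteq> 0"
  shows "complex_eigenvalue A (of_real l)"
proof -
  have "(\<Sum>j\<in>UNIV. A $ i $ j * x $ j) = l * x $ i" for i
    using assms(1) by (simp add: matrix_vector_mult_def vec_eq_iff)
  then have "(\<Sum>j\<in>UNIV. complex_of_real (A $ i $ j) * complex_of_real (x $ j)) = of_real l * of_real (x $ i)" for i
    by (metis (mono_tags, lifting) of_real_mult of_real_sum sum.cong)
  moreover have "(\<chi> i. complex_of_real (x $ i)) \<noteq> 0"
    using assms(2) by (auto simp: vec_eq_iff)
  ultimately show ?thesis
    unfolding complex_eigenvalue_def
    by (intro exI[of _ "\<chi> i. complex_of_real (x $ i)"])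
       (auto simp: matrix_vector_mult_def vec_eq_iff)
qed

text \<open>A positive vector that \<open>A\<close> contracts by the factor \<open>r\<close> bounds every eigenvalue by \<open>r\<close>: compare
  an eigenvector with it in the weighted maximum norm.\<close>

lemma complex_eigenvalue_le:
  fixes A :: "real ^ 'n ^ 'n" and v :: "real ^ 'n"
  assumes A: "\<And>i j. 0 \<le> A $ i $ j" and v: "\<And>i. 0 < v $ i" and le: "\<And>i. (A *v v) $ i \<le> r * v $ i"
    and z: "complex_eigenvalue A z"
  shows "cmod z \<le> r"
proof -
  obtain u :: "complex ^ 'n" where u: "u \<noteq> 0"
    and eig: "(\<chi> i j. complex_of_real (A $ i $ j)) *v u = z *s u"
    using z unfolding complex_eigenvalue_def by blast
  define c where "c = Max (range (\<lambda>i. cmod (u $ i) / v $ i))"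
  have c: "cmod (u $ i) / v $ i \<le> c" for i
    unfolding c_def by (intro Max_ge) auto
  have cu: "cmod (u $ i) \<le> c * v $ i" for i
    using c[of i] v[of i] by (simp add: divide_le_eq)
  have "c \<in> range (\<lambda>i. cmod (u $ i) / v $ i)"
    unfolding c_def by (intro Max_in) auto
  then obtain i where i: "c = cmod (u $ i) / v $ i"
    by blast
  have c_eq: "cmod (u $ i) = c * v $ i"
    using i v[of i] by simp
  obtain j where "u $ j \<noteq> 0"
    using u by (auto simp: vec_eq_iff)
  then have "0 < cmod (u $ j) / v $ j"
    using v[of j] by simp
  then have cpos: "0 < c"
    using c[of j] by linarith
  have "z * u $ i = (\<Sum>j\<in>UNIV. complex_of_real (A $ i $ j) * u $ j)"
    using eig by (simp add: matrix_vector_mult_def vec_eq_iff)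
  then have "cmod z * cmod (u $ i) \<le> (\<Sum>j\<in>UNIV. A $ i $ j * cmod (u $ j))"
    using norm_sum[of "\<lambda>j. complex_of_real (A $ i $ j) * u $ j" UNIV] A
    by (simp add: norm_mult[of z, symmetric]) (simp add: norm_mult)
  also have "\<dots> \<le> (\<Sum>j\<in>UNIV. A $ i $ j * (c * v $ j))"
    using A cu by (intro sum_mono mult_left_mono)
  also have "\<dots> = c * (A *v v) $ i"
    by (simp add: matrix_vector_mult_def sum_distrib_left mult_ac)
  also have "\<dots> \<le> c * (r * v $ i)"
    using cpos le by simp
  finally have "cmod z * (c * v $ i) \<le> r * (c * v $ i)"
    by (simp add: c_eq mult_ac)
  then show ?thesis
    using cpos v[of i] by simp
qed

text \<open>The all-ones vector is used, with the sum of all entries as factor. Without boundedness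
  the real \<open>Sup\<close> need not bound its members.\<close>

lemma bdd_above_eigenvalues:
  fixes A :: "real ^ 'n ^ 'n"
  assumes A: "\<And>i j. 0 \<le> A $ i $ j"
  shows "bdd_above (cmod ` Collect (complex_eigenvalue A))"
proof -
  have "cmod z \<le> (\<Sum>i\<in>UNIV. (A *v 1) $ i)" if "complex_eigenvalue A z" for z
  proof (rule complex_eigenvalue_le[OF A, of 1])
    have "0 \<le> (A *v 1) $ i" for i
      using A by (auto simp: matrix_vector_mult_def intro!: sum_nonneg)
    then show "(A *v 1) $ i \<le> (\<Sum>i\<in>UNIV. (A *v 1) $ i) * 1 $ i" for i
      using member_le_sum[of i UNIV "\<lambda>i. (A *v 1) $ i"] by simp
  qed (use that in auto)
  then show ?thesis
    by (intro bdd_aboveI2) auto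
qed

text \<open>The cone is the whole space here. Nonemptiness keeps \<open>Sup\<close> away from the
  empty set, where no upper bound could be derived.\<close>

lemma eigenvalues_nonempty:
  fixes A :: "real ^ 'n ^ 'n"
  assumes A: "\<And>i j. 0 \<le> A $ i $ j"
  shows "Collect (complex_eigenvalue A) \<noteq> {}"
proof -
  obtain x l where "x \<noteq> 0" "A *v x = l *\<^sub>R x"
    by (rule nonneg_matrix_eigenvalue_on_cone[OF A, of UNIV 1]) auto
  then show ?thesis
    using complex_eigenvalue_of_real by blast
qed

text \<open>The Collatz-Wielandt upper bound; \<open>contracted_positive_vector\<close> is its
  converse for the threshold 1.\<close>

lemma spr_le:
  fixes A :: "real ^ 'n ^ 'n" and v :: "real ^ 'n"
  assumes "\<And>i j. 0 \<le> A $ i $ j" "\<And>i. 0 < v $ i" "\<And>i. (A *v v) $ i \<le> r * v $ i"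
  shows "spr A \<le> r"
  unfolding spr_eq using eigenvalues_nonempty[OF assms(1)] complex_eigenvalue_le[OF assms]
  by (intro cSup_least) auto

section \<open>Matrices of spectral radius below 1\<close>

context
  fixes A :: "real ^ 'n ^ 'n"
  assumes A: "\<And>i j. 0 \<le> A $ i $ j" and spr: "spr A < 1"
begin

text \<open>A nonzero nonnegative eigenvector inside the cone \<open>K\<close> has eigenvalue at
  least 1, so Brouwer's argument is run on \<open>K\<close>. The map \<open>x + A *v x\<close>
  preserves \<open>K\<close>, since \<open>A\<close> is nonnegative and hence preserves the
  inequality \<open>0 \<le> A *v x - x\<close>.\<close>

lemma no_expanded_vector:
  assumes x: "\<And>i. 0 \<le> x $ i" "\<And>i. x $ i \<le> (A *v x) $ i"
  shows "x = 0"
proof (rule ccontr)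
  assume "x \<noteq> 0"
  define K where "K = {x :: real ^ 'n. \<forall>i. x $ i \<le> (A *v x) $ i}"
  have "K = (\<Inter>i. {x :: real ^ 'n. x $ i \<le> (A *v x) $ i})"
    by (auto simp: K_def)
  moreover have "continuous_on UNIV (\<lambda>x. A *v x)"
    by (intro linear_continuous_on matrix_vector_mul_bounded_linear)
  then have "closed {x :: real ^ 'n. x $ i \<le> (A *v x) $ i}" for i
    by (intro closed_Collect_le continuous_intros)
  ultimately have "closed K"
    by auto
  moreover have "convex K"
    unfolding K_def convex_def
    by (auto simp: matrix_vector_right_distrib matrix_vector_mult_scaleR intro!: add_mono mult_left_mono)
  moreover have "c *\<^sub>R y \<in> K" if "y \<in> K" "0 \<le> c" for y c
    using that unfolding K_def by (auto simp: matrix_vector_mult_scaleR intro!: mult_left_mono)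
  moreover have "y + A *v y \<in> K" if "y \<in> K" for y
  proof -
    have "0 \<le> (A *v (A *v y - y)) $ i" for i
      using that A unfolding K_def
      by (auto simp: matrix_vector_mult_def[of A "A *v y - y"] intro!: sum_nonneg mult_nonneg_nonneg)
    then show ?thesis
      using that unfolding K_def
      by (fastforce simp: matrix_vector_right_distrib matrix_vector_mult_diff_distrib intro: add_mono order_trans)
  qed
  moreover have "x \<in> K"
    using x by (simp add: K_def)
  ultimately obtain y l where y: "y \<in> K" "\<And>i. 0 \<le> y $ i" "y \<noteq> 0" "A *v y = l *\<^sub>R y" "0 \<le> l"
    by (rule nonneg_matrix_eigenvalue_on_cone[OF A, of K x]) (use x(1) \<open>x \<noteq> 0\<close> in simp_all)
  obtain i where "y $ i \<noteq> 0"
    using y(3) by (auto simp: vec_eq_iff)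
  then have "0 < y $ i"
    using y(2)[of i] by simp
  moreover have "y $ i \<le> l * y $ i"
    using y(1,4) by (simp add: K_def)
  ultimately have "1 \<le> l"
    by simp
  moreover have "cmod (of_real l) \<le> spr A"
    unfolding spr_eq using bdd_above_eigenvalues[OF A] complex_eigenvalue_of_real[OF y(4,3)]
    by (intro cSup_upper imageI) simp_all
  ultimately show False
    using spr by simp
qed

text \<open>A kernel vector satisfies \<open>A *v x = x\<close>; by the triangle inequality its
  entrywise absolute value is expanded by \<open>A\<close>, hence zero.\<close>

lemma invertible_mat_1_minus: "invertible (mat 1 - A)"
proof -
  have "x = 0" if x: "(mat 1 - A) *v x = 0" for x
  proof -
    have Ax: "A *v x = x"
      using x by (simp add: matrix_vector_mult_diff_rdistrib)
    have "(\<chi> i. \<bar>x $ i\<bar>) = 0"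
    proof (rule no_expanded_vector)
      fix i
      have "\<bar>x $ i\<bar> = \<bar>\<Sum>j\<in>UNIV. A $ i $ j * x $ j\<bar>"
        using Ax by (simp add: matrix_vector_mult_def vec_eq_iff)
      also have "\<dots> \<le> (\<Sum>j\<in>UNIV. \<bar>A $ i $ j * x $ j\<bar>)"
        by (rule sum_abs)
      also have "\<dots> = (A *v (\<chi> i. \<bar>x $ i\<bar>)) $ i"
        using A by (simp add: matrix_vector_mult_def abs_mult)
      finally show "(\<chi> i. \<bar>x $ i\<bar>) $ i \<le> (A *v (\<chi> i. \<bar>x $ i\<bar>)) $ i"
        by simp
    qed simp
    then show "x = 0"
      by (auto simp: vec_eq_iff)
  qed
  then show ?thesis
    by (metis invertible_left_inverse matrix_left_invertible_ker)
qed

text \<open>The negative part \<open>n\<close> of \<open>x\<close> is expanded by \<open>A\<close>: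
  as \<open>x + n\<close> is nonnegative, \<open>- A x \<le> A n\<close>, and so
  \<open>- x = - y - A x \<le> A n\<close>.\<close>

lemma resolvent_vector_nonneg:
  assumes x: "x = y + A *v x" and y: "\<And>i. 0 \<le> y $ i"
  shows "0 \<le> x $ i"
proof -
  define n where "n = (\<chi> i. max 0 (- x $ i))"
  have "n = 0"
  proof (rule no_expanded_vector)
    fix i
    have "(A *v (x + n)) $ i \<ge> 0"
      unfolding matrix_vector_mult_def n_def using A by (auto intro!: sum_nonneg mult_nonneg_nonneg)
    then have "- x $ i \<le> (A *v n) $ i"
      using y[of i] arg_cong[OF x, of "\<lambda>v. v $ i"] by (simp add: matrix_vector_right_distrib)
    moreover have "0 \<le> (A *v n) $ i"
      unfolding matrix_vector_mult_def n_def using A by (auto intro!: sum_nonneg)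
    ultimately show "n $ i \<le> (A *v n) $ i"
      by (simp add: n_def)
  qed (simp add: n_def)
  then have "max 0 (- x $ i) = 0"
    by (metis n_def vec_lambda_beta zero_index)
  then show ?thesis
    by simp
qed

lemma resolvent_eq: "matrix_inv (mat 1 - A) = mat 1 + A ** matrix_inv (mat 1 - A)"
proof -
  have "(mat 1 - A) ** matrix_inv (mat 1 - A) = mat 1"
    unfolding matrix_inv_def
    by (rule someI2_ex[OF invertible_mat_1_minus[unfolded invertible_def]]) simp
  moreover have "(mat 1 - A) ** X = X - A ** X" for X :: "real ^ 'n ^ 'n"
    by (simp add: vec_eq_iff matrix_matrix_mult_def mat_def left_diff_distrib sum_subtractf if_distrib[of "\<lambda>x. x * _"] cong: if_cong)
  ultimately show ?thesis
    by (simp add: diff_eq_eq)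
qed

text \<open>Column \<open>j\<close> of the inverse solves \<open>x = e + A x\<close> with
  \<open>e\<close> the unit vector of index \<open>j\<close>.\<close>

lemma resolvent_nonneg: "0 \<le> matrix_inv (mat 1 - A) $ i $ j"
proof -
  define B where "B = matrix_inv (mat 1 - A)"
  have B: "B $ i $ j = (mat 1 :: real ^ 'n ^ 'n) $ i $ j + (\<Sum>k\<in>UNIV. A $ i $ k * B $ k $ j)" for i j
    using arg_cong[OF resolvent_eq, of "\<lambda>X. X $ i $ j"] unfolding B_def[symmetric]
    by (simp add: matrix_matrix_mult_def)
  have "column j B = (\<chi> i. (mat 1 :: real ^ 'n ^ 'n) $ i $ j) + A *v column j B"
  proof (intro vec_eq_iff[THEN iffD2] allI)
    fix i
    show "column j B $ i = ((\<chi> i. (mat 1 :: real ^ 'n ^ 'n) $ i $ j) + A *v column j B) $ i"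
      unfolding vector_add_component matrix_vector_mult_def column_def vec_lambda_beta by (rule B)
  qed
  then have "0 \<le> column j B $ i"
    by (rule resolvent_vector_nonneg) (simp add: mat_def)
  then show ?thesis
    unfolding column_def vec_lambda_beta B_def .
qed

text \<open>The image \<open>v\<close> of the all-ones vector under the inverse satisfies
  \<open>A v = v - 1\<close>, which is strictly below \<open>v\<close> in every coordinate; the
  largest of the finitely many ratios serves as \<open>r\<close>. In this form the condition on
  \<open>spr\<close> passes to submatrices.\<close>

lemma contracted_positive_vector:
  obtains v :: "real ^ 'n" and r where "\<And>i. 0 < v $ i" "\<And>i. (A *v v) $ i \<le> r * v $ i" "r < 1"
proof -
  define v where "v = matrix_inv (mat 1 - A) *v 1"
  have v: "v = 1 + A *v v"
    unfolding v_def matrix_vector_mul_assoc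
    by (subst resolvent_eq) (simp add: matrix_vector_mult_add_rdistrib)
  then have "0 \<le> v $ i" for i
    by (rule resolvent_vector_nonneg) simp
  then have "0 \<le> (A *v v) $ i" for i
    using A by (auto simp: matrix_vector_mult_def intro!: sum_nonneg)
  moreover have vi: "v $ i = 1 + (A *v v) $ i" for i
    using arg_cong[OF v, of "\<lambda>v. v $ i"] by simp
  ultimately have pos: "0 < v $ i" for i
    by (metis add_pos_nonneg zero_less_one)
  define r where "r = Max (range (\<lambda>i. (A *v v) $ i / v $ i))"
  have "r \<in> range (\<lambda>i. (A *v v) $ i / v $ i)"
    unfolding r_def by (intro Max_in) auto
  then have "r < 1"
    using pos vi by (auto simp: divide_less_eq)
  moreover have "(A *v v) $ i / v $ i \<le> r" for i
    unfolding r_def by (intro Max_ge) auto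
  then have "(A *v v) $ i \<le> r * v $ i" for i
    using pos by (simp add: divide_le_eq)
  ultimately show thesis
    using that pos by blast
qed

end

text \<open>The contracted vector, restricted to the indices \<open>Inr\<close>, stays positive, and
  dropping the other nonnegative summands of a row only lowers it, so the same factor
  \<open>r\<close> works.\<close>

lemma spr_less_one_submatrix:
  fixes H :: "'m::finite + 'p::finite \<Rightarrow> 'm + 'p \<Rightarrow> ennreal"
  assumes "spr_less_one H"
  shows "spr_less_one (\<lambda>p p'. H (Inr p) (Inr p'))"
proof -
  have nn: "0 \<le> real_matrix H $ i $ j" for i j
    by (simp add: real_matrix_def)
  from assms have "spr (real_matrix H) < 1" and fin: "\<And>i j. H i j < \<infinity>"
    by (auto simp: spr_less_one_def)
  then obtain v r where v: "\<And>i. 0 < v $ i" "\<And>i. (real_matrix H *v v) $ i \<le> r * v $ i" "r < 1"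
    using contracted_positive_vector[OF nn] by blast
  define w where "w = (\<chi> p :: 'p. v $ Inr p)"
  let ?A = "real_matrix (\<lambda>p p'. H (Inr p) (Inr p'))"
  have "(?A *v w) $ p \<le> (real_matrix H *v v) $ Inr p" for p
  proof -
    have "(?A *v w) $ p = (\<Sum>i\<in>range Inr. enn2real (H (Inr p) i) * v $ i)"
      by (simp add: matrix_vector_mult_def real_matrix_def w_def sum.reindex)
    also have "\<dots> \<le> (\<Sum>i\<in>UNIV. enn2real (H (Inr p) i) * v $ i)"
      using v(1) by (intro sum_mono2) (auto simp: less_imp_le)
    finally show ?thesis
      by (simp add: matrix_vector_mult_def real_matrix_def)
  qed
  then have "(?A *v w) $ p \<le> r * w $ p" for p
    using v(2)[of "Inr p"] order_trans by (fastforce simp: w_def)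
  then have "spr ?A \<le> r"
    using v(1) by (intro spr_le[of _ w]) (auto simp: real_matrix_def w_def)
  then show ?thesis
    using v(3) fin by (auto simp: spr_less_one_def)
qed

section \<open>Grids and coefficients\<close>

lemma countable_grid: "countable (grid P p)"
  unfolding grid_def by simp

lemma countable_grid_points: "countable (grid_points (P :: ('m, 'p::finite) har_params))"
proof -
  have "grid_points P = Sigma UNIV (grid P)"
    by (auto simp: grid_points_def)
  then show ?thesis
    using countable_grid by (metis countable_SIGMA countable_finite finite)
qed

lemma finite_grid_atLeastAtMost: "finite (grid P p \<inter> {a..b})"
  by (rule finite_subset[OF _ finite_grid_Int[of P p a "b + 1"]]) auto

text \<open>The induction runs over all grids at once, since a value at \<open>k\<close> may refer
  to earlier points of every type. For real \<open>a\<close> only finitely many points lie in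
  \<open>{a..<k}\<close>, which makes it well founded.\<close>

lemma grid_induct [consumes 2, case_names step]:
  fixes P :: "('m, 'p::finite) har_params"
  assumes "k \<in> grid P p" "a \<le> k"
    and step: "\<And>p k. k \<in> grid P p \<Longrightarrow> a \<le> k \<Longrightarrow>
      (\<And>q l. l \<in> grid P q \<Longrightarrow> a \<le> l \<Longrightarrow> l < k \<Longrightarrow> Q q l) \<Longrightarrow> Q p k"
  shows "Q p k"
  using assms(1,2)
proof (induction "card ((\<Union>q. grid P q) \<inter> {a..<k})" arbitrary: p k rule: less_induct)
  case less
  show ?case
  proof (rule step)
    fix q l assume l: "l \<in> grid P q" "a \<le> l" "l < k"
    have "finite ((\<Union>q. grid P q) \<inter> {a..<k})"
      using finite_grid_Int[of P _ a k] by (simp add: UN_extend_simps del: UN_simps)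
    moreover have "(\<Union>q. grid P q) \<inter> {a..<l} \<subset> (\<Union>q. grid P q) \<inter> {a..<k}"
      using l by fastforce
    ultimately show "Q q l"
      using l by (intro less.hyps psubset_card_mono)
  qed (use less.prems in auto)
qed

text \<open>The spacing \<open>1 / freq P p\<close> divides 1, so integers are periods of every grid
  simultaneously.\<close>

lemma add_int_mem_grid_iff:
  assumes "1 \<le> freq P p"
  shows "x + of_int j \<in> grid P p \<longleftrightarrow> x \<in> grid P p"
proof -
  have *: "x + of_int j \<in> grid P p" if x: "x \<in> grid P p" for x j
  proof -
    obtain i :: int where "x = of_int i / real (freq P p) + phase P p"
      using x by (auto simp: grid_def)
    then have "x + of_int j = of_int (i + j * int (freq P p)) / real (freq P p) + phase P p"
      using assms by (simp add: field_simps)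
    then show ?thesis
      unfolding grid_def by blast
  qed
  show ?thesis
    using *[of x j] *[of "x + of_int j" "- j"] by auto
qed

lemma coef_less: "k < k' \<Longrightarrow> coef P p k p' k' = 0"
  by (simp add: coef.simps)

lemma coef_self: "coef P p k p' k = (if p = p' then 1 else 0)"
  by (simp add: coef.simps)

lemma coef_nonneg:
  assumes "\<And>p p' x. 0 \<le> hfun P (Inr p) (Inr p') x"
  shows "0 \<le> coef P p k p' k'"
  using assms
proof (induction P p k p' k' rule: coef.induct)
  case (1 P p k p' k')
  then show ?case
    by (subst coef.simps) (auto intro!: sum_nonneg mult_nonneg_nonneg)
qed

text \<open>The recursion sees only time differences and the grids, and both are invariant under a
  common integer shift.\<close>

lemma coef_add_int:
  assumes "\<And>p. 1 \<le> freq P p"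
  shows "coef P p (k + of_int j) p' (k' + of_int j) = coef P p k p' k'"
  using assms
proof (induction P p k p' k' rule: coef.induct)
  case (1 P p k p' k')
  have img: "grid P q \<inter> {k' + of_int j..<k + of_int j} = (\<lambda>x. x + of_int j) ` (grid P q \<inter> {k'..<k})" for q
  proof -
    have "x \<in> (\<lambda>x. x + of_int j) ` (grid P q \<inter> {k'..<k})"
      if "x \<in> grid P q" "k' + of_int j \<le> x" "x < k + of_int j" for x
      using that add_int_mem_grid_iff[OF "1.prems", of "x - of_int j" j q]
      by (intro image_eqI[of _ _ "x - of_int j"]) auto
    then show ?thesis
      using add_int_mem_grid_iff[OF "1.prems"] by auto
  qed
  have IH: "coef P q (l + of_int j) p' (k' + of_int j) = coef P q l p' k'"
    if "k' < k" "l \<in> grid P q \<inter> {k'..<k}" for q l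
    using that by (intro "1.IH" "1.prems") auto
  have "(\<Sum>q\<in>UNIV. \<Sum>l\<in>grid P q \<inter> {k' + of_int j..<k + of_int j}.
           hfun P (Inr p) (Inr q) (k + of_int j - l) * coef P q l p' (k' + of_int j)) =
        (\<Sum>q\<in>UNIV. \<Sum>l\<in>grid P q \<inter> {k'..<k}.
           hfun P (Inr p) (Inr q) (k - l) * coef P q l p' k')" if "k' < k"
    unfolding img by (subst sum.reindex) (auto simp: IH[OF that] intro!: sum.cong)
  then show ?case
    by (subst (1 2) coef.simps) auto
qed

section \<open>The recursion on the grids from a real starting time, and its resolvent\<close>

definition grid_convolution ::
    "('m, 'p::finite) har_params \<Rightarrow> real \<Rightarrow> ('p \<Rightarrow> real \<Rightarrow> real) \<Rightarrow> 'p \<Rightarrow> real \<Rightarrow> real" where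
  "grid_convolution P a V p k =
     (\<Sum>q\<in>UNIV. \<Sum>l\<in>grid P q \<inter> {a..<k}. hfun P (Inr p) (Inr q) (k - l) * V q l)"

text \<open>The inverse of \<open>Id - grid_convolution P a\<close>, written with the coefficients
  as its kernel.\<close>

definition grid_resolvent ::
    "('m, 'p::finite) har_params \<Rightarrow> real \<Rightarrow> ('p \<Rightarrow> real \<Rightarrow> real) \<Rightarrow> 'p \<Rightarrow> real \<Rightarrow> real" where
  "grid_resolvent P a F p k = (\<Sum>q\<in>UNIV. \<Sum>l\<in>grid P q \<inter> {a..k}. coef P p k q l * F q l)"

text \<open>The coefficients satisfy the recursion in their first argument, with the diagonal value
  as source. Summing against \<open>F\<close> and exchanging the two sums gives the
  equation.\<close>

lemma grid_resolvent_eq: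
  assumes k: "k \<in> grid P p" "a \<le> k"
  shows "grid_resolvent P a F p k = F p k + grid_convolution P a (grid_resolvent P a F) p k"
proof -
  define h where "h q = hfun P (Inr p) (Inr q)" for q
  \<comment> \<open>The diagonal term \<open>l = k\<close> is split off; it counts only for
    \<open>q = p\<close>, even when \<open>k\<close> lies on other grids too.\<close>
  have "(\<Sum>l\<in>grid P q \<inter> {a..k}. coef P p k q l * F q l) =
      (if q = p then F p k else 0) + (\<Sum>l\<in>grid P q \<inter> {a..<k}. coef P p k q l * F q l)" for q
  proof (cases "k \<in> grid P q")
    case True
    then have "grid P q \<inter> {a..k} = insert k (grid P q \<inter> {a..<k})"
      using k by auto
    then show ?thesis
      by (simp add: finite_grid_Int coef_self)
  next
    case False
    then have "grid P q \<inter> {a..k} = grid P q \<inter> {a..<k}"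
      by (auto simp: less_le)
    then show ?thesis
      using False k by auto
  qed
  then have "grid_resolvent P a F p k =
      F p k + (\<Sum>q\<in>UNIV. \<Sum>l\<in>grid P q \<inter> {a..<k}. coef P p k q l * F q l)"
    unfolding grid_resolvent_def by (simp add: sum.distrib)
  also have "(\<Sum>q\<in>UNIV. \<Sum>l\<in>grid P q \<inter> {a..<k}. coef P p k q l * F q l) =
      (\<Sum>q\<in>UNIV. \<Sum>l\<in>grid P q \<inter> {a..<k}. \<Sum>q'\<in>UNIV. \<Sum>l'\<in>grid P q' \<inter> {a..<k}.
         h q' (k - l') * (coef P q' l' q l * F q l))"
  proof (intro sum.cong refl)
    fix q l assume l: "l \<in> grid P q \<inter> {a..<k}"
    \<comment> \<open>Coefficients vanish when the first time precedes the second, so the range can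
      be enlarged to one independent of \<open>l\<close>; only then can the sums be swapped.\<close>
    have "(\<Sum>l'\<in>grid P q' \<inter> {l..<k}. h q' (k - l') * coef P q' l' q l) =
        (\<Sum>l'\<in>grid P q' \<inter> {a..<k}. h q' (k - l') * coef P q' l' q l)" for q'
      using l by (intro sum.mono_neutral_left finite_grid_Int) (auto, metis coef_less not_le)
    then have "coef P p k q l =
        (\<Sum>q'\<in>UNIV. \<Sum>l'\<in>grid P q' \<inter> {a..<k}. h q' (k - l') * coef P q' l' q l)"
      using l by (subst coef.simps) (simp add: h_def)
    then show "coef P p k q l * F q l = (\<Sum>q'\<in>UNIV. \<Sum>l'\<in>grid P q' \<inter> {a..<k}.
         h q' (k - l') * (coef P q' l' q l * F q l))"
      by (simp add: sum_distrib_right mult.assoc)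
  qed
  also have "\<dots> = (\<Sum>q'\<in>UNIV. \<Sum>l'\<in>grid P q' \<inter> {a..<k}. \<Sum>q\<in>UNIV. \<Sum>l\<in>grid P q \<inter> {a..<k}.
         h q' (k - l') * (coef P q' l' q l * F q l))"
  proof -
    define T where "T = (SIGMA q:UNIV. grid P q \<inter> {a..<k})"
    have T: "(\<Sum>q\<in>UNIV. \<Sum>l\<in>grid P q \<inter> {a..<k}. f q l) = (\<Sum>x\<in>T. f (fst x) (snd x))"
      for f :: "'b \<Rightarrow> real \<Rightarrow> real"
      by (simp add: T_def sum.Sigma finite_grid_Int case_prod_unfold)
    show ?thesis
      unfolding T by (rule sum.swap)
  qed
  also have "\<dots> = grid_convolution P a (grid_resolvent P a F) p k"
    unfolding grid_convolution_def
  proof (intro sum.cong refl)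
    fix q' l' assume l': "l' \<in> grid P q' \<inter> {a..<k}"
    have "(\<Sum>l\<in>grid P q \<inter> {a..<k}. coef P q' l' q l * F q l) =
        (\<Sum>l\<in>grid P q \<inter> {a..l'}. coef P q' l' q l * F q l)" for q
      using l' by (intro sum.mono_neutral_right finite_grid_Int) (auto, metis coef_less not_le)
    then show "(\<Sum>q\<in>UNIV. \<Sum>l\<in>grid P q \<inter> {a..<k}. h q' (k - l') * (coef P q' l' q l * F q l)) =
        hfun P (Inr p) (Inr q') (k - l') * grid_resolvent P a F q' l'"
      by (simp add: grid_resolvent_def h_def flip: sum_distrib_left)
  qed
  finally show ?thesis .
qed

text \<open>Only strictly earlier grid values enter the right-hand side, so two solutions agree by
  induction along the grid.\<close>

lemma grid_resolvent_unique:
  assumes eq: "\<And>p k. k \<in> grid P p \<Longrightarrow> a \<le> k \<Longrightarrow> V p k = F p k + grid_convolution P a V p k"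
    and "k \<in> grid P p" "a \<le> k"
  shows "V p k = grid_resolvent P a F p k"
  using assms(2,3)
proof (induction rule: grid_induct)
  case (step p k)
  have "grid_convolution P a V p k = grid_convolution P a (grid_resolvent P a F) p k"
    unfolding grid_convolution_def using step.IH by (intro sum.cong refl) auto
  then show ?case
    using eq[OF step.hyps] grid_resolvent_eq[OF step.hyps] by simp
qed

lemma nn_integral_grid_le_amalgam_norm:
  assumes "1 \<le> freq P p"
  shows "(\<integral>\<^sup>+k. ennreal \<bar>f (x - k)\<bar> \<partial>count_space (grid P p)) \<le> amalgam_norm (real (freq P p)) f"
proof -
  \<comment> \<open>The index carries a minus sign so that \<open>x - k\<close> becomes
    \<open>x - phase P p + j / freq P p\<close>; the supremum in \<open>amalgam_norm\<close> absorbs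
    the offset.\<close>
  have "bij_betw (\<lambda>j::int. phase P p - real_of_int j / real (freq P p)) UNIV (grid P p)"
  proof (intro bij_betwI')
    fix y assume "y \<in> grid P p"
    then obtain j :: int where "y = real_of_int j / real (freq P p) + phase P p"
      by (auto simp: grid_def)
    then show "\<exists>j\<in>UNIV. y = phase P p - real_of_int j / real (freq P p)"
      by (intro bexI[of _ "- j"]) auto
  next
    fix j :: int
    have "phase P p - real_of_int j / real (freq P p) = real_of_int (- j) / real (freq P p) + phase P p"
      by simp
    then show "phase P p - real_of_int j / real (freq P p) \<in> grid P p"
      unfolding grid_def by blast
  qed (use assms in auto)
  then have "(\<integral>\<^sup>+k. ennreal \<bar>f (x - k)\<bar> \<partial>count_space (grid P p)) =
      (\<integral>\<^sup>+j. ennreal \<bar>f (x - (phase P p - real_of_int j / real (freq P p)))\<bar> \<partial>count_space UNIV)"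
    by (rule nn_integral_bij_count_space[symmetric])
  also have "\<dots> = (\<integral>\<^sup>+j. ennreal \<bar>f ((x - phase P p) + real_of_int j / real (freq P p))\<bar> \<partial>count_space UNIV)"
    by (simp add: algebra_simps)
  also have "\<dots> \<le> amalgam_norm (real (freq P p)) f"
    unfolding amalgam_norm_def by (intro SUP_upper) simp
  finally show ?thesis .
qed

text \<open>Monotone convergence for the truncations that let a starting time tend to
  \<open>-\<infinity>\<close>.\<close>

lemma nn_integral_atLeast_LIMSEQ:
  fixes f :: "real \<Rightarrow> ennreal"
  shows "(\<lambda>n. \<integral>\<^sup>+x\<in>{- real n..}. f x \<partial>count_space A) \<longlonglongrightarrow> (\<integral>\<^sup>+x. f x \<partial>count_space A)"
proof (rule nn_integral_LIMSEQ)
  show "incseq (\<lambda>n x. f x * indicator {- real n..} x)"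
    by (auto simp: incseq_def le_fun_def split: split_indicator)
  fix x :: real
  have "eventually (\<lambda>n. - x \<le> real n) sequentially"
    by real_asymp
  then have "eventually (\<lambda>n. f x * indicator {- real n..} x = f x) sequentially"
    by eventually_elim (auto split: split_indicator)
  then show "(\<lambda>n. f x * indicator {- real n..} x) \<longlonglongrightarrow> f x"
    by (rule tendsto_eventually)
qed auto

section \<open>Elementary bounds and summability of the coefficients\<close>

locale linear_parameters =
  fixes P :: "('m::finite, 'p::finite) har_params"
  assumes linear_params: "linear_params P"
begin

lemma freq_ge_1: "1 \<le> freq P p"
  and hfun_nonneg: "0 \<le> hfun P \<alpha> \<beta> x"
  and bfun_nonneg: "0 \<le> bfun P \<alpha> p x"
  and base_nonneg: "0 \<le> base P m"
  and hfun_eq_0: "x \<le> 0 \<Longrightarrow> hfun P \<alpha> \<beta> x = 0"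
  and hfun_measurable [measurable]: "hfun P \<alpha> \<beta> \<in> borel_measurable borel"
  using linear_params by (auto simp: linear_params_def kernel_def)

lemma coef_nonneg': "0 \<le> coef P p k p' k'"
  by (intro coef_nonneg hfun_nonneg)

lemma nn_integral_hfun_grid_le:
  "(\<integral>\<^sup>+l. ennreal (hfun P \<alpha> (Inr p) (x - l)) \<partial>count_space (grid P p)) \<le> H_full P \<alpha> (Inr p)"
  using nn_integral_grid_le_amalgam_norm[OF freq_ge_1, of p "hfun P \<alpha> (Inr p)" x]
  by (simp add: H_full_def hfun_nonneg)

lemma nn_integral_grid_eq_sum:
  assumes "\<And>l. l \<in> grid P q \<Longrightarrow> a \<le> l \<Longrightarrow> l \<le> b \<Longrightarrow> 0 \<le> f l"
  shows "(\<integral>\<^sup>+l\<in>{a..b}. ennreal (f l) \<partial>count_space (grid P q)) =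
    ennreal (\<Sum>l\<in>grid P q \<inter> {a..b}. f l)"
  using assms
  by (subst nn_integral_count_space'[of "grid P q \<inter> {a..b}"])
     (auto simp: finite_grid_atLeastAtMost split: split_indicator intro!: sum_ennreal)

end

text \<open>The contraction condition concerns the grid-to-grid block, from which alone the
  coefficients are built.\<close>

locale subcritical = linear_parameters P
  for P :: "('m::finite, 'p::finite) har_params" +
  assumes spr: "spr_less_one (H_WW P)"
begin

definition H_inv :: "'p \<Rightarrow> 'p \<Rightarrow> real" where
  "H_inv p p' = matrix_inv (mat 1 - real_matrix (H_WW P)) $ p $ p'"

lemma H_inv_eq: "H_inv p p' = (if p = p' then 1 else 0) + (\<Sum>q\<in>UNIV. enn2real (H_WW P p q) * H_inv q p')"
  and H_inv_nonneg: "0 \<le> H_inv p p'"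
proof -
  have nn: "0 \<le> real_matrix (H_WW P) $ i $ j" for i j
    by (simp add: real_matrix_def)
  have s: "spr (real_matrix (H_WW P)) < 1"
    using spr by (simp add: spr_less_one_def)
  show "0 \<le> H_inv p p'"
    unfolding H_inv_def by (rule resolvent_nonneg[OF nn s])
  show "H_inv p p' = (if p = p' then 1 else 0) + (\<Sum>q\<in>UNIV. enn2real (H_WW P p q) * H_inv q p')"
    using arg_cong[OF resolvent_eq[OF nn s], of "\<lambda>X. X $ p $ p'"]
    unfolding H_inv_def by (simp add: matrix_matrix_mult_def mat_def real_matrix_def)
qed

lemma sum_hfun_le: "(\<Sum>l\<in>grid P q \<inter> {a..<k}. hfun P (Inr p) (Inr q) (k - l)) \<le> enn2real (H_WW P p q)"
proof -
  have "ennreal (\<Sum>l\<in>grid P q \<inter> {a..<k}. hfun P (Inr p) (Inr q) (k - l)) =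
      (\<integral>\<^sup>+l\<in>{a..<k}. ennreal (hfun P (Inr p) (Inr q) (k - l)) \<partial>count_space (grid P q))"
    by (subst nn_integral_count_space'[of "grid P q \<inter> {a..<k}"])
       (auto simp: finite_grid_Int sum_ennreal hfun_nonneg split: split_indicator)
  also have "\<dots> \<le> (\<integral>\<^sup>+l. ennreal (hfun P (Inr p) (Inr q) (k - l)) \<partial>count_space (grid P q))"
    by (intro nn_integral_mono) (auto split: split_indicator)
  also have "\<dots> \<le> H_WW P p q"
    unfolding H_WW_def by (rule nn_integral_hfun_grid_le)
  also have "\<dots> = ennreal (enn2real (H_WW P p q))"
    using spr by (simp add: spr_less_one_def)
  finally show ?thesis
    by (simp add: ennreal_le_iff)
qed

text \<open>\<open>H_inv\<close> solves \<open>X = Id + H X\<close>. The coefficient sums satisfy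
  the matching inequality along the grid, so induction keeps them below \<open>H_inv\<close>,
  uniformly in \<open>a\<close>.\<close>

lemma sum_coef_le:
  assumes "k \<in> grid P p" "a \<le> k"
  shows "(\<Sum>l\<in>grid P p' \<inter> {a..k}. coef P p k p' l) \<le> H_inv p p'"
proof -
  \<comment> \<open>With the indicator of type \<open>p'\<close> as source, the resolvent is the
    coefficient sum in question.\<close>
  define F where "F q l = (if q = p' then 1 else 0 :: real)" for q :: 'p and l :: real
  have F: "grid_resolvent P a F p k = (\<Sum>l\<in>grid P p' \<inter> {a..k}. coef P p k p' l)" for p k
    unfolding grid_resolvent_def F_def
    by (subst sum.remove[of UNIV p']) (auto intro!: sum.neutral)
  from assms have "grid_resolvent P a F p k \<le> H_inv p p'"
  proof (induction rule: grid_induct)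
    case (step p k)
    have "grid_resolvent P a F p k = F p k + grid_convolution P a (grid_resolvent P a F) p k"
      by (rule grid_resolvent_eq[OF step.hyps])
    also have "grid_convolution P a (grid_resolvent P a F) p k \<le>
        (\<Sum>q\<in>UNIV. \<Sum>l\<in>grid P q \<inter> {a..<k}. hfun P (Inr p) (Inr q) (k - l) * H_inv q p')"
      unfolding grid_convolution_def using step.IH
      by (intro sum_mono mult_left_mono hfun_nonneg) auto
    also have "\<dots> \<le> (\<Sum>q\<in>UNIV. enn2real (H_WW P p q) * H_inv q p')"
      unfolding sum_distrib_right[symmetric]
      by (intro sum_mono mult_right_mono H_inv_nonneg sum_hfun_le)
    finally show ?case
      using H_inv_eq[of p p'] F_def[of p k] by simp
  qed
  then show ?thesis
    by (simp add: F)
qed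

lemma nn_integral_coef_le:
  assumes k: "k \<in> grid P p"
  shows "(\<integral>\<^sup>+l. ennreal (coef P p k p' l) \<partial>count_space (grid P p')) \<le> ennreal (H_inv p p')"
proof (rule LIMSEQ_le_const2[OF nn_integral_atLeast_LIMSEQ])
  have "eventually (\<lambda>n. - k \<le> real n) sequentially"
    by real_asymp
  then obtain N where N: "\<And>n. N \<le> n \<Longrightarrow> - real n \<le> k"
    by (auto simp: eventually_sequentially minus_le_iff)
  have "(\<integral>\<^sup>+l\<in>{- real n..}. ennreal (coef P p k p' l) \<partial>count_space (grid P p')) \<le> ennreal (H_inv p p')"
    if "N \<le> n" for n
  proof -
    have "(\<integral>\<^sup>+l\<in>{- real n..}. ennreal (coef P p k p' l) \<partial>count_space (grid P p')) =
        (\<integral>\<^sup>+l\<in>{- real n..k}. ennreal (coef P p k p' l) \<partial>count_space (grid P p'))"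
      by (intro nn_integral_cong) (auto simp: coef_less split: split_indicator)
    also have "\<dots> = ennreal (\<Sum>l\<in>grid P p' \<inter> {- real n..k}. coef P p k p' l)"
      by (intro nn_integral_grid_eq_sum coef_nonneg')
    also have "\<dots> \<le> ennreal (H_inv p p')"
      using N[OF that] by (intro ennreal_leI sum_coef_le k)
    finally show ?thesis .
  qed
  then show "\<exists>N. \<forall>n\<ge>N. (\<integral>\<^sup>+l\<in>{- real n..}. ennreal (coef P p k p' l) \<partial>count_space (grid P p')) \<le> ennreal (H_inv p p')"
    by blast
qed

end

section \<open>The norm of the cluster kernel\<close>

text \<open>Countability of \<open>I\<close> makes \<open>count_space I\<close> sigma-finite even
  when the ambient type is uncountable, and measurability is asked of the summands indexed by
  \<open>I\<close> only.\<close>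

lemma borel_measurable_nn_integral_count_space:
  fixes f :: "'i \<Rightarrow> 'a \<Rightarrow> ennreal"
  assumes "countable I" and [measurable]: "\<And>i. i \<in> I \<Longrightarrow> f i \<in> borel_measurable M"
  shows "(\<lambda>x. \<integral>\<^sup>+i. f i x \<partial>count_space I) \<in> borel_measurable M"
proof -
  interpret sigma_finite_measure "count_space I"
    using assms(1) by (rule sigma_finite_measure_count_space_countable)
  have "(\<lambda>z. f (snd z) (fst z)) \<in> borel_measurable (M \<Otimes>\<^sub>M count_space I)"
    by (rule measurable_compose_countable'[where f = "\<lambda>i z. f i (fst z)" and g = snd and I = I])
       (use assms in auto)
  then have "(\<lambda>(x, i). f i x) \<in> borel_measurable (M \<Otimes>\<^sub>M count_space I)"
    by (simp add: case_prod_unfold)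
  then show ?thesis
    by (rule borel_measurable_nn_integral)
qed

text \<open>Euclidean division of the grid index by \<open>freq P p\<close> sorts the grid into
  classes modulo 1, each a translate of the integers. As only an upper bound is wanted, covering the
  grid suffices.\<close>

lemma nn_integral_grid_le_sum_mod_1:
  assumes n: "1 \<le> freq P p"
  shows "(\<integral>\<^sup>+k. f k \<partial>count_space (grid P p)) \<le>
    (\<Sum>r<freq P p. \<integral>\<^sup>+j. f (real r / real (freq P p) + phase P p + of_int j) \<partial>count_space UNIV)"
proof -
  define g where "g r j = real r / real (freq P p) + phase P p + of_int j" for r and j :: int
  have grid: "grid P p \<subseteq> (\<Union>r<freq P p. range (g r))"
  proof
    fix k assume "k \<in> grid P p"
    then obtain i :: int where i: "k = of_int i / real (freq P p) + phase P p"
      by (auto simp: grid_def)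
    define j where "j = i div int (freq P p)"
    define r where "r = nat (i mod int (freq P p))"
    have "i = j * int (freq P p) + int r"
      using n by (simp add: j_def r_def)
    then have "of_int i = real_of_int j * real (freq P p) + real r"
      by (metis of_int_add of_int_mult of_int_of_nat_eq)
    then have "k = g r j"
      using n by (simp add: i g_def field_simps)
    moreover have "r < freq P p"
      using n by (simp add: r_def nat_less_iff)
    ultimately show "k \<in> (\<Union>r<freq P p. range (g r))"
      by blast
  qed
  have "(\<integral>\<^sup>+k. f k \<partial>count_space (grid P p)) = (\<integral>\<^sup>+k. f k * indicator (grid P p) k \<partial>count_space UNIV)"
    by (rule nn_integral_count_space_indicator) simp
  also have "\<dots> \<le> (\<integral>\<^sup>+k. (\<Sum>r<freq P p. f k * indicator (range (g r)) k) \<partial>count_space UNIV)"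
  proof (intro nn_integral_mono)
    fix k
    show "f k * indicator (grid P p) k \<le> (\<Sum>r<freq P p. f k * indicator (range (g r)) k)"
    proof (cases "k \<in> grid P p")
      case True
      then obtain r where "r < freq P p" "k \<in> range (g r)"
        using grid by blast
      then show ?thesis
        using member_le_sum[of r "{..<freq P p}" "\<lambda>r. f k * indicator (range (g r)) k"] True by simp
    qed simp
  qed
  also have "\<dots> = (\<Sum>r<freq P p. \<integral>\<^sup>+k. f k * indicator (range (g r)) k \<partial>count_space UNIV)"
    by (rule nn_integral_sum) simp
  also have "\<dots> = (\<Sum>r<freq P p. \<integral>\<^sup>+j. f (g r j) \<partial>count_space UNIV)"
  proof (intro sum.cong refl)
    fix r
    have "(\<integral>\<^sup>+k. f k * indicator (range (g r)) k \<partial>count_space UNIV) = (\<integral>\<^sup>+k. f k \<partial>count_space (range (g r)))"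
      by (rule nn_integral_count_space_indicator[symmetric]) simp
    also have "\<dots> = (\<integral>\<^sup>+j. f (g r j) \<partial>count_space UNIV)"
      by (rule nn_integral_bij_count_space[symmetric]) (auto simp: bij_betw_def inj_on_def g_def)
    finally show "(\<integral>\<^sup>+k. f k * indicator (range (g r)) k \<partial>count_space UNIV) = (\<integral>\<^sup>+j. f (g r j) \<partial>count_space UNIV)" .
  qed
  finally show ?thesis
    by (simp add: g_def)
qed

text \<open>Moving \<open>k\<close> and \<open>l\<close> by the same integer leaves \<open>coef P p k p' l\<close> unchanged, so the sum over \<open>k\<close>
  within a class modulo 1 can be moved onto \<open>hfun\<close>; the grid has \<open>freq P p\<close> such classes.\<close>

lemma (in subcritical) nn_integral_coef_hfun_le:
  "(\<integral>\<^sup>+k. \<integral>\<^sup>+l. ennreal (coef P p k p' l) * ennreal (hfun P (Inr p') (Inl m) (l - s))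
      \<partial>count_space (grid P p') \<partial>count_space (grid P p))
   \<le> of_nat (freq P p) * (ennreal (H_inv p p') * amalgam_norm 1 (hfun P (Inr p') (Inl m)))"
proof -
  define h where "h x = ennreal (hfun P (Inr p') (Inl m) x)" for x
  define A where "A = amalgam_norm 1 (hfun P (Inr p') (Inl m))"
  define f where "f k = (\<integral>\<^sup>+l. ennreal (coef P p k p' l) * h (l - s) \<partial>count_space (grid P p'))" for k
  have period: "(\<integral>\<^sup>+j. f (k + of_int j) \<partial>count_space UNIV) \<le> ennreal (H_inv p p') * A"
    if k: "k \<in> grid P p" for k
  proof -
    have bij: "bij_betw (\<lambda>l. l + of_int j) (grid P p') (grid P p')" for j
    proof (intro bij_betwI')
      fix y assume "y \<in> grid P p'"
      then show "\<exists>x\<in>grid P p'. y = x + of_int j"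
        using add_int_mem_grid_iff[OF freq_ge_1, of y "- j"] by (intro bexI[of _ "y - of_int j"]) auto
    qed (auto simp: add_int_mem_grid_iff[OF freq_ge_1])
    have "f (k + of_int j) = (\<integral>\<^sup>+l. ennreal (coef P p k p' l) * h (l - s + of_int j) \<partial>count_space (grid P p'))" for j
      unfolding f_def
      by (subst nn_integral_bij_count_space[OF bij, of _ j, symmetric])
         (simp add: coef_add_int[OF freq_ge_1] diff_add_eq)
    then have "(\<integral>\<^sup>+j. f (k + of_int j) \<partial>count_space UNIV) =
        (\<integral>\<^sup>+j. \<integral>\<^sup>+l. ennreal (coef P p k p' l) * h (l - s + of_int j) \<partial>count_space (grid P p') \<partial>count_space UNIV)"
      by simp
    also have "\<dots> = (\<integral>\<^sup>+l. \<integral>\<^sup>+j. ennreal (coef P p k p' l) * h (l - s + of_int j) \<partial>count_space UNIV \<partial>count_space (grid P p'))"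
      by (intro nn_integral_count_space_nn_integral countable_grid) simp
    also have "\<dots> \<le> (\<integral>\<^sup>+l. ennreal (coef P p k p' l) * A \<partial>count_space (grid P p'))"
    proof (intro nn_integral_mono)
      fix l
      have "(\<integral>\<^sup>+j. h (l - s + of_int j) \<partial>count_space UNIV) \<le> A"
        unfolding A_def amalgam_norm_def h_def
        by (rule SUP_upper2[of "l - s"]) (auto simp: hfun_nonneg)
      then show "(\<integral>\<^sup>+j. ennreal (coef P p k p' l) * h (l - s + of_int j) \<partial>count_space UNIV) \<le> ennreal (coef P p k p' l) * A"
        by (simp add: nn_integral_cmult mult_left_mono)
    qed
    also have "\<dots> = (\<integral>\<^sup>+l. ennreal (coef P p k p' l) \<partial>count_space (grid P p')) * A"
      by (simp add: nn_integral_multc)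
    also have "\<dots> \<le> ennreal (H_inv p p') * A"
      by (intro mult_right_mono nn_integral_coef_le k) simp
    finally show ?thesis .
  qed
  have "real r / real (freq P p) + phase P p \<in> grid P p" for r
  proof -
    have "real r / real (freq P p) + phase P p = real_of_int (int r) / real (freq P p) + phase P p"
      by simp
    then show ?thesis
      unfolding grid_def by blast
  qed
  then have "(\<Sum>r<freq P p. \<integral>\<^sup>+j. f (real r / real (freq P p) + phase P p + of_int j) \<partial>count_space UNIV) \<le>
      (\<Sum>r<freq P p. ennreal (H_inv p p') * A)"
    by (intro sum_mono period)
  then show ?thesis
    using nn_integral_grid_le_sum_mod_1[OF freq_ge_1, of p f]
    by (simp add: f_def h_def A_def)
qed

text \<open>Dropping the order constraints on \<open>s\<close>, \<open>l\<close>, \<open>k\<close>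
  and \<open>t\<close> only enlarges the nonnegative sums. Then the integral over \<open>t\<close>
  meets a single \<open>hfun\<close> and equals an \<open>l1_norm\<close> independent of
  \<open>k\<close>, leaving the double sum of \<open>nn_integral_coef_hfun_le\<close>.\<close>

lemma (in subcritical) nn_integral_cluster_kernel_le:
  "(\<integral>\<^sup>+t\<in>{s<..}. cluster_kernel P m m0 s t \<partial>lborel)
   \<le> l1_norm (hfun P (Inl m) (Inl m0)) +
     (\<Sum>p\<in>UNIV. \<Sum>p'\<in>UNIV. of_nat (freq P p) * l1_norm (hfun P (Inl m) (Inr p)) *
        ennreal (H_inv p p') * amalgam_norm 1 (hfun P (Inr p') (Inl m0)))"
proof -
  define c where "c p p' k = (\<integral>\<^sup>+l. ennreal (coef P p k p' l) * ennreal (hfun P (Inr p') (Inl m0) (l - s))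
      \<partial>count_space (grid P p'))" for p p' k
  have "cluster_kernel P m m0 s t \<le> ennreal (hfun P (Inl m) (Inl m0) (t - s)) +
      (\<Sum>p\<in>UNIV. \<Sum>p'\<in>UNIV. \<integral>\<^sup>+k. ennreal (hfun P (Inl m) (Inr p) (t - k)) * c p p' k \<partial>count_space (grid P p))" for t
    unfolding cluster_kernel_def
  proof (intro add_left_mono sum_mono nn_integral_mono)
    fix p p' k
    have "(\<integral>\<^sup>+l\<in>{s<..k}. ennreal (hfun P (Inl m) (Inr p) (t - k)) * ennreal (coef P p k p' l) *
           ennreal (hfun P (Inr p') (Inl m0) (l - s)) \<partial>count_space (grid P p')) \<le>
        (\<integral>\<^sup>+l. ennreal (hfun P (Inl m) (Inr p) (t - k)) * (ennreal (coef P p k p' l) *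
           ennreal (hfun P (Inr p') (Inl m0) (l - s))) \<partial>count_space (grid P p'))"
      by (intro nn_integral_mono) (auto simp: mult.assoc split: split_indicator)
    also have "\<dots> = ennreal (hfun P (Inl m) (Inr p) (t - k)) * c p p' k"
      by (simp add: c_def nn_integral_cmult)
    finally show "(\<integral>\<^sup>+l\<in>{s<..k}. ennreal (hfun P (Inl m) (Inr p) (t - k)) * ennreal (coef P p k p' l) *
           ennreal (hfun P (Inr p') (Inl m0) (l - s)) \<partial>count_space (grid P p')) * indicator {s<..<t} k
       \<le> ennreal (hfun P (Inl m) (Inr p) (t - k)) * c p p' k"
      by (auto split: split_indicator)
  qed
  then have "(\<integral>\<^sup>+t\<in>{s<..}. cluster_kernel P m m0 s t \<partial>lborel) \<le>
      (\<integral>\<^sup>+t. ennreal (hfun P (Inl m) (Inl m0) (t - s)) +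
      (\<Sum>p\<in>UNIV. \<Sum>p'\<in>UNIV. \<integral>\<^sup>+k. ennreal (hfun P (Inl m) (Inr p) (t - k)) * c p p' k \<partial>count_space (grid P p)) \<partial>lborel)"
    by (intro nn_integral_mono) (auto split: split_indicator)
  also have "\<dots> = (\<integral>\<^sup>+t. ennreal (hfun P (Inl m) (Inl m0) (t - s)) \<partial>lborel) +
      (\<Sum>p\<in>UNIV. \<Sum>p'\<in>UNIV. \<integral>\<^sup>+t. \<integral>\<^sup>+k. ennreal (hfun P (Inl m) (Inr p) (t - k)) * c p p' k \<partial>count_space (grid P p) \<partial>lborel)"
  proof -
    have [measurable]: "(\<lambda>t. \<integral>\<^sup>+k. ennreal (hfun P (Inl m) (Inr p) (t - k)) * c p p' k \<partial>count_space (grid P p))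
        \<in> borel_measurable lborel" for p p'
      by (intro borel_measurable_nn_integral_count_space countable_grid) measurable
    show ?thesis
      by (simp add: nn_integral_add nn_integral_sum)
  qed
  also have "\<dots> \<le> l1_norm (hfun P (Inl m) (Inl m0)) +
      (\<Sum>p\<in>UNIV. \<Sum>p'\<in>UNIV. of_nat (freq P p) * l1_norm (hfun P (Inl m) (Inr p)) *
        ennreal (H_inv p p') * amalgam_norm 1 (hfun P (Inr p') (Inl m0)))"
  proof (intro add_mono sum_mono)
    have shift: "(\<integral>\<^sup>+t. ennreal (hfun P \<alpha> \<beta> (t - x)) \<partial>lborel) = l1_norm (hfun P \<alpha> \<beta>)" for \<alpha> \<beta> x
      unfolding l1_norm_def
      by (subst nn_integral_real_affine[of _ 1 "- x"]) (simp_all add: hfun_nonneg)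
    show "(\<integral>\<^sup>+t. ennreal (hfun P (Inl m) (Inl m0) (t - s)) \<partial>lborel) \<le> l1_norm (hfun P (Inl m) (Inl m0))"
      by (simp add: shift)
    fix p p'
    have "(\<integral>\<^sup>+t. \<integral>\<^sup>+k. ennreal (hfun P (Inl m) (Inr p) (t - k)) * c p p' k \<partial>count_space (grid P p) \<partial>lborel) =
        (\<integral>\<^sup>+k. \<integral>\<^sup>+t. ennreal (hfun P (Inl m) (Inr p) (t - k)) * c p p' k \<partial>lborel \<partial>count_space (grid P p))"
      by (intro nn_integral_count_space_nn_integral countable_grid) measurable
    also have "\<dots> = (\<integral>\<^sup>+k. l1_norm (hfun P (Inl m) (Inr p)) * c p p' k \<partial>count_space (grid P p))"
      by (simp add: nn_integral_multc shift)
    also have "\<dots> = l1_norm (hfun P (Inl m) (Inr p)) * (\<integral>\<^sup>+k. c p p' k \<partial>count_space (grid P p))"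
      by (simp add: nn_integral_cmult)
    also have "\<dots> \<le> l1_norm (hfun P (Inl m) (Inr p)) *
        (of_nat (freq P p) * (ennreal (H_inv p p') * amalgam_norm 1 (hfun P (Inr p') (Inl m0))))"
      unfolding c_def by (intro mult_left_mono nn_integral_coef_hfun_le) simp
    finally show "(\<integral>\<^sup>+t. \<integral>\<^sup>+k. ennreal (hfun P (Inl m) (Inr p) (t - k)) * c p p' k \<partial>count_space (grid P p) \<partial>lborel)
       \<le> of_nat (freq P p) * l1_norm (hfun P (Inl m) (Inr p)) *
          ennreal (H_inv p p') * amalgam_norm 1 (hfun P (Inr p') (Inl m0))"
      by (simp add: mult_ac)
  qed
  finally show ?thesis .
qed

section \<open>Solving the recursion along a realization\<close>

lemma ennreal_set_integral:
  fixes f :: "'b \<Rightarrow> real"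
  assumes "set_integrable M A f" "\<And>x. x \<in> space M \<Longrightarrow> x \<in> A \<Longrightarrow> 0 \<le> f x"
  shows "ennreal (LINT x:A|M. f x) = (\<integral>\<^sup>+x\<in>A. ennreal (f x) \<partial>M)"
    and "0 \<le> (LINT x:A|M. f x)"
proof -
  have "(\<integral>\<^sup>+x. ennreal (indicator A x *\<^sub>R f x) \<partial>M) = ennreal (LINT x:A|M. f x)"
    unfolding set_lebesgue_integral_def using assms
    by (intro nn_integral_eq_integral AE_I2) (auto simp: set_integrable_def split: split_indicator)
  moreover have "(\<integral>\<^sup>+x. ennreal (indicator A x *\<^sub>R f x) \<partial>M) = (\<integral>\<^sup>+x\<in>A. ennreal (f x) \<partial>M)"
    by (intro nn_integral_cong) (auto split: split_indicator)
  ultimately show "ennreal (LINT x:A|M. f x) = (\<integral>\<^sup>+x\<in>A. ennreal (f x) \<partial>M)"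
    by simp
  show "0 \<le> (LINT x:A|M. f x)"
    unfolding set_lebesgue_integral_def using assms(2)
    by (intro integral_nonneg_AE AE_I2) (auto split: split_indicator)
qed

lemma ennreal_abs_set_integral_le:
  fixes f :: "'b \<Rightarrow> real"
  assumes "set_integrable M A f"
  shows "ennreal \<bar>LINT x:A|M. f x\<bar> \<le> (\<integral>\<^sup>+x\<in>A. ennreal \<bar>f x\<bar> \<partial>M)"
proof -
  have "ennreal \<bar>LINT x:A|M. f x\<bar> \<le> (\<integral>\<^sup>+x. norm (indicator A x *\<^sub>R f x) \<partial>M)"
    using integral_norm_bound_ennreal[OF assms[unfolded set_integrable_def]]
    by (simp add: set_lebesgue_integral_def)
  also have "\<dots> = (\<integral>\<^sup>+x\<in>A. ennreal \<bar>f x\<bar> \<partial>M)"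
    by (intro nn_integral_cong) (auto split: split_indicator)
  finally show ?thesis .
qed

context linear_parameters
begin

text \<open>In \<open>ennreal\<close> sums can later be split and exchanged freely. Convergence is
  what rules out the default value 0 of the real integrals.\<close>

lemma ennreal_har_input:
  assumes conv: "har_input_converges P t0 N W \<alpha> t"
    and W: "\<And>p k. k \<in> grid P p \<Longrightarrow> k \<in> ico t0 t \<Longrightarrow> 0 \<le> W p k"
  shows "ennreal (har_input P t0 N W \<alpha> t) =
      (\<Sum>m\<in>UNIV. \<integral>\<^sup>+s\<in>ico t0 t. ennreal (hfun P \<alpha> (Inl m) (t - s)) \<partial>count_space (N m)) +
      (\<Sum>p\<in>UNIV. \<integral>\<^sup>+k\<in>ico t0 t. (ennreal (hfun P \<alpha> (Inr p) (t - k)) * ennreal (W p k) +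
         ennreal (bfun P \<alpha> p (t - k))) \<partial>count_space (grid P p))"
    and "0 \<le> har_input P t0 N W \<alpha> t"
proof -
  have N_int: "set_integrable (count_space (N m)) (ico t0 t) (\<lambda>s. hfun P \<alpha> (Inl m) (t - s))"
    and W_int: "set_integrable (count_space (grid P p)) (ico t0 t)
      (\<lambda>k. hfun P \<alpha> (Inr p) (t - k) * W p k + bfun P \<alpha> p (t - k))" for m p
    using conv by (auto simp: har_input_converges_def)
  note N_val = ennreal_set_integral[OF N_int hfun_nonneg]
  have W_nn: "0 \<le> hfun P \<alpha> (Inr p) (t - k) * W p k + bfun P \<alpha> p (t - k)"
    if "k \<in> space (count_space (grid P p))" "k \<in> ico t0 t" for p k
    using that W by (simp add: hfun_nonneg bfun_nonneg)
  note W_val = ennreal_set_integral[OF W_int W_nn]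
  show "0 \<le> har_input P t0 N W \<alpha> t"
    unfolding har_input_def by (intro add_nonneg_nonneg sum_nonneg N_val(2) W_val(2))
  have ennreal_sums: "ennreal (sum a UNIV + sum b UNIV) = (\<Sum>m\<in>UNIV. ennreal (a m)) + (\<Sum>p\<in>UNIV. ennreal (b p))"
    if "\<And>m. 0 \<le> a m" "\<And>p. 0 \<le> b p" for a :: "'m \<Rightarrow> real" and b :: "'p \<Rightarrow> real"
    using that by (simp add: sum_nonneg)
  have "ennreal (har_input P t0 N W \<alpha> t) =
      (\<Sum>m\<in>UNIV. ennreal (LINT s:ico t0 t|count_space (N m). hfun P \<alpha> (Inl m) (t - s))) +
      (\<Sum>p\<in>UNIV. ennreal (LINT k:ico t0 t|count_space (grid P p).
        (hfun P \<alpha> (Inr p) (t - k) * W p k + bfun P \<alpha> p (t - k))))"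
    unfolding har_input_def by (intro ennreal_sums N_val(2) W_val(2))
  also have "\<dots> = (\<Sum>m\<in>UNIV. \<integral>\<^sup>+s\<in>ico t0 t. ennreal (hfun P \<alpha> (Inl m) (t - s)) \<partial>count_space (N m)) +
      (\<Sum>p\<in>UNIV. \<integral>\<^sup>+k\<in>ico t0 t. ennreal (hfun P \<alpha> (Inr p) (t - k) * W p k +
         bfun P \<alpha> p (t - k)) \<partial>count_space (grid P p))"
    by (intro arg_cong2[of _ _ _ _ "(+)"] sum.cong refl N_val(1) W_val(1))
  also have "\<dots> = (\<Sum>m\<in>UNIV. \<integral>\<^sup>+s\<in>ico t0 t. ennreal (hfun P \<alpha> (Inl m) (t - s)) \<partial>count_space (N m)) +
      (\<Sum>p\<in>UNIV. \<integral>\<^sup>+k\<in>ico t0 t. (ennreal (hfun P \<alpha> (Inr p) (t - k)) * ennreal (W p k) +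
         ennreal (bfun P \<alpha> p (t - k))) \<partial>count_space (grid P p))"
    using W by (intro arg_cong2[of _ _ _ _ "(+)"] sum.cong refl nn_integral_cong)
      (auto simp: hfun_nonneg bfun_nonneg ennreal_mult ennreal_plus split: split_indicator)
  finally show "ennreal (har_input P t0 N W \<alpha> t) =
      (\<Sum>m\<in>UNIV. \<integral>\<^sup>+s\<in>ico t0 t. ennreal (hfun P \<alpha> (Inl m) (t - s)) \<partial>count_space (N m)) +
      (\<Sum>p\<in>UNIV. \<integral>\<^sup>+k\<in>ico t0 t. (ennreal (hfun P \<alpha> (Inr p) (t - k)) * ennreal (W p k) +
         ennreal (bfun P \<alpha> p (t - k))) \<partial>count_space (grid P p))" .
qed

section \<open>Exchanging sums over points and over grids\<close>

definition Y_total :: "('p \<Rightarrow> real \<Rightarrow> real) \<Rightarrow> ('m \<Rightarrow> real set) \<Rightarrow> ereal \<Rightarrow> 'p \<Rightarrow> real \<Rightarrow> ennreal" where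
  "Y_total x N t0 p k = Y_b P t0 p k + Y_xi P x t0 p k +
     (\<Sum>m\<in>UNIV. \<integral>\<^sup>+ s\<in>ico t0 k. Y_pt P m t0 s p k \<partial>count_space (N m))"

lemma sum_nn_integral_Y_pt:
  "(\<Sum>m\<in>UNIV. \<integral>\<^sup>+s\<in>ico t0 k. Y_pt P m t0 s p k \<partial>count_space (N m)) =
   (\<Sum>q\<in>UNIV. \<integral>\<^sup>+l\<in>icc t0 k. ennreal (coef P p k q l) *
      (\<Sum>m\<in>UNIV. \<integral>\<^sup>+s\<in>ico t0 l. ennreal (hfun P (Inr q) (Inl m) (l - s)) \<partial>count_space (N m))
      \<partial>count_space (grid P q))"
proof -
  \<comment> \<open>The ranges of \<open>l\<close> and \<open>s\<close> are made independent; the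
    constraint \<open>s < l\<close> is restored by \<open>hfun\<close>, which vanishes at
    nonpositive arguments.\<close>
  define g where "g m q l s = ennreal (coef P p k q l) * ennreal (hfun P (Inr q) (Inl m) (l - s)) *
      indicator (icc t0 k) l * indicator (ico t0 k) s" for m q l s
  have "(\<Sum>q\<in>UNIV. \<integral>\<^sup>+l\<in>icc t0 k. ennreal (coef P p k q l) *
      (\<Sum>m\<in>UNIV. \<integral>\<^sup>+s\<in>ico t0 l. ennreal (hfun P (Inr q) (Inl m) (l - s)) \<partial>count_space (N m))
      \<partial>count_space (grid P q)) =
      (\<Sum>q\<in>UNIV. \<integral>\<^sup>+l. (\<Sum>m\<in>UNIV. \<integral>\<^sup>+s. g m q l s \<partial>count_space (N m)) \<partial>count_space (grid P q))"
  proof (intro sum.cong refl nn_integral_cong)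
    fix q l
    have "(\<integral>\<^sup>+s. g m q l s \<partial>count_space (N m)) = ennreal (coef P p k q l) *
        (\<integral>\<^sup>+s\<in>ico t0 l. ennreal (hfun P (Inr q) (Inl m) (l - s)) \<partial>count_space (N m)) * indicator (icc t0 k) l" for m
    proof -
      have "(\<integral>\<^sup>+s. g m q l s \<partial>count_space (N m)) =
         (\<integral>\<^sup>+s. ennreal (coef P p k q l) * indicator (icc t0 k) l *
            (ennreal (hfun P (Inr q) (Inl m) (l - s)) * indicator (ico t0 l) s) \<partial>count_space (N m))"
        by (intro nn_integral_cong)
           (auto simp: g_def icc_def ico_def hfun_eq_0 split: split_indicator)
      also have "\<dots> = ennreal (coef P p k q l) * indicator (icc t0 k) l *
          (\<integral>\<^sup>+s\<in>ico t0 l. ennreal (hfun P (Inr q) (Inl m) (l - s)) \<partial>count_space (N m))"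
        by (rule nn_integral_cmult) simp
      finally show ?thesis
        by (simp only: mult_ac)
    qed
    then show "ennreal (coef P p k q l) *
      (\<Sum>m\<in>UNIV. \<integral>\<^sup>+s\<in>ico t0 l. ennreal (hfun P (Inr q) (Inl m) (l - s)) \<partial>count_space (N m)) * indicator (icc t0 k) l =
      (\<Sum>m\<in>UNIV. \<integral>\<^sup>+s. g m q l s \<partial>count_space (N m))"
      by (simp add: sum_distrib_left sum_distrib_right)
  qed
  also have "\<dots> = (\<Sum>q\<in>UNIV. \<Sum>m\<in>UNIV. \<integral>\<^sup>+l. \<integral>\<^sup>+s. g m q l s \<partial>count_space (N m) \<partial>count_space (grid P q))"
    by (simp add: nn_integral_sum)
  \<comment> \<open>The exchange rests on the countability of the grid; \<open>N m\<close> is an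
    arbitrary set here.\<close>
  also have "\<dots> = (\<Sum>m\<in>UNIV. \<Sum>q\<in>UNIV. \<integral>\<^sup>+s. \<integral>\<^sup>+l. g m q l s \<partial>count_space (grid P q) \<partial>count_space (N m))"
    by (subst sum.swap) (simp add: nn_integral_count_space_nn_integral countable_grid)
  also have "\<dots> = (\<Sum>m\<in>UNIV. \<integral>\<^sup>+s. (\<Sum>q\<in>UNIV. \<integral>\<^sup>+l. g m q l s \<partial>count_space (grid P q)) \<partial>count_space (N m))"
    by (simp add: nn_integral_sum)
  also have "\<dots> = (\<Sum>m\<in>UNIV. \<integral>\<^sup>+s\<in>ico t0 k. Y_pt P m t0 s p k \<partial>count_space (N m))"
    by (simp add: g_def Y_pt_def nn_integral_multc sum_distrib_right)
  finally show ?thesis by simp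
qed

text \<open>A point acts on the intensity directly or through grid values. For the second route
  \<open>cluster_kernel\<close> is \<open>hfun\<close> applied to \<open>Y_pt\<close>, so that
  summing over the points reproduces the point part of the grid values.\<close>

lemma sum_nn_integral_cluster_kernel:
  "(\<Sum>m'\<in>UNIV. \<integral>\<^sup>+s\<in>ico t0 t. cluster_kernel P m m' s t \<partial>count_space (N m')) =
   (\<Sum>m'\<in>UNIV. \<integral>\<^sup>+s\<in>ico t0 t. ennreal (hfun P (Inl m) (Inl m') (t - s)) \<partial>count_space (N m')) +
   (\<Sum>p\<in>UNIV. \<integral>\<^sup>+k\<in>ico t0 t. ennreal (hfun P (Inl m) (Inr p) (t - k)) *
      (\<Sum>m'\<in>UNIV. \<integral>\<^sup>+s\<in>ico t0 k. Y_pt P m' t0 s p k \<partial>count_space (N m')) \<partial>count_space (grid P p))"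
proof -
  define J where "J m' p k s = ennreal (hfun P (Inl m) (Inr p) (t - k)) * indicator (ico t0 t) k *
      (Y_pt P m' t0 s p k * indicator (ico t0 k) s)" for m' p k s
  \<comment> \<open>\<open>cluster_kernel\<close> sums over \<open>k'\<close> in
    \<open>{s<..k}\<close> and \<open>Y_pt\<close> over \<open>icc t0 k\<close>. These agree:
    \<open>hfun\<close> vanishes for \<open>k' \<le> s\<close>, and \<open>k' > s\<close> implies
    \<open>t0 \<le> k'\<close>.\<close>
  have J: "(\<Sum>p'\<in>UNIV. (\<integral>\<^sup>+ k'\<in>{s<..k}.
           ennreal (hfun P (Inl m) (Inr p) (t - k)) * ennreal (coef P p k p' k') *
           ennreal (hfun P (Inr p') (Inl m') (k' - s)) \<partial>count_space (grid P p')) * indicator {s<..<t} k)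
      * indicator (ico t0 t) s = J m' p k s" for m' p k s
  proof (cases "s \<in> ico t0 t \<and> s < k \<and> k < t")
    case True
    then have ind: "k \<in> ico t0 t" "s \<in> ico t0 k" "s \<in> ico t0 t" "k \<in> {s<..<t}" and t0: "t0 \<le> ereal s"
      by (auto simp: ico_def intro: order_trans)
    have "(\<integral>\<^sup>+ k'\<in>{s<..k}.
           ennreal (hfun P (Inl m) (Inr p) (t - k)) * ennreal (coef P p k p' k') *
           ennreal (hfun P (Inr p') (Inl m') (k' - s)) \<partial>count_space (grid P p')) =
        (\<integral>\<^sup>+ k'. ennreal (hfun P (Inl m) (Inr p) (t - k)) * (ennreal (coef P p k p' k') *
           ennreal (hfun P (Inr p') (Inl m') (k' - s)) * indicator (icc t0 k) k') \<partial>count_space (grid P p'))" for p'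
    proof (intro nn_integral_cong)
      fix k'
      show "ennreal (hfun P (Inl m) (Inr p) (t - k)) * ennreal (coef P p k p' k') *
           ennreal (hfun P (Inr p') (Inl m') (k' - s)) * indicator {s<..k} k' =
         ennreal (hfun P (Inl m) (Inr p) (t - k)) * (ennreal (coef P p k p' k') *
           ennreal (hfun P (Inr p') (Inl m') (k' - s)) * indicator (icc t0 k) k')"
      proof (cases "k' \<le> s")
        case True
        then show ?thesis by (simp add: hfun_eq_0)
      next
        case False
        then have "t0 \<le> ereal k'"
          using t0 by (meson ereal_less_eq(3) le_cases order_trans)
        then show ?thesis
          using False by (auto simp: icc_def mult.assoc split: split_indicator)
      qed
    qed
    then show ?thesis
      using ind by (simp add: J_def Y_pt_def nn_integral_cmult sum_distrib_left)
  next
    case False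
    moreover have "s \<in> ico t0 t" if "k \<in> ico t0 t" "s \<in> ico t0 k"
      using that by (auto simp: ico_def)
    ultimately show ?thesis
      by (auto simp: J_def ico_def split: split_indicator)
  qed
  have pull: "(\<Sum>p\<in>UNIV. \<Sum>p'\<in>UNIV. \<integral>\<^sup>+k. R p p' k \<partial>count_space (grid P p)) * c =
      (\<Sum>p\<in>UNIV. \<integral>\<^sup>+k. (\<Sum>p'\<in>UNIV. R p p' k) * c \<partial>count_space (grid P p))"
    for R :: "'p \<Rightarrow> 'p \<Rightarrow> real \<Rightarrow> ennreal" and c
    by (simp add: nn_integral_sum nn_integral_multc sum_distrib_right)
  have "cluster_kernel P m m' s t * indicator (ico t0 t) s =
      ennreal (hfun P (Inl m) (Inl m') (t - s)) * indicator (ico t0 t) s +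
      (\<Sum>p\<in>UNIV. \<integral>\<^sup>+k. J m' p k s \<partial>count_space (grid P p))" for m' s
    unfolding cluster_kernel_def J[symmetric] distrib_right pull ..
  then have "(\<Sum>m'\<in>UNIV. \<integral>\<^sup>+s\<in>ico t0 t. cluster_kernel P m m' s t \<partial>count_space (N m')) =
     (\<Sum>m'\<in>UNIV. \<integral>\<^sup>+s\<in>ico t0 t. ennreal (hfun P (Inl m) (Inl m') (t - s)) \<partial>count_space (N m')) +
     (\<Sum>m'\<in>UNIV. \<Sum>p\<in>UNIV. \<integral>\<^sup>+s. \<integral>\<^sup>+k. J m' p k s \<partial>count_space (grid P p) \<partial>count_space (N m'))"
    by (simp add: nn_integral_add nn_integral_sum sum.distrib)
  also have "(\<Sum>m'\<in>UNIV. \<Sum>p\<in>UNIV. \<integral>\<^sup>+s. \<integral>\<^sup>+k. J m' p k s \<partial>count_space (grid P p) \<partial>count_space (N m')) =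
      (\<Sum>p\<in>UNIV. \<Sum>m'\<in>UNIV. \<integral>\<^sup>+k. \<integral>\<^sup>+s. J m' p k s \<partial>count_space (N m') \<partial>count_space (grid P p))"
    by (subst sum.swap) (simp add: nn_integral_count_space_nn_integral countable_grid)
  also have "\<dots> = (\<Sum>p\<in>UNIV. \<integral>\<^sup>+k. (\<Sum>m'\<in>UNIV. \<integral>\<^sup>+s. J m' p k s \<partial>count_space (N m')) \<partial>count_space (grid P p))"
    by (simp add: nn_integral_sum)
  also have "\<dots> = (\<Sum>p\<in>UNIV. \<integral>\<^sup>+k\<in>ico t0 t. ennreal (hfun P (Inl m) (Inr p) (t - k)) *
      (\<Sum>m'\<in>UNIV. \<integral>\<^sup>+s\<in>ico t0 k. Y_pt P m' t0 s p k \<partial>count_space (N m')) \<partial>count_space (grid P p))"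
  proof (intro sum.cong refl nn_integral_cong)
    fix p k
    have "(\<integral>\<^sup>+s. J m' p k s \<partial>count_space (N m')) = ennreal (hfun P (Inl m) (Inr p) (t - k)) * indicator (ico t0 t) k *
        (\<integral>\<^sup>+s\<in>ico t0 k. Y_pt P m' t0 s p k \<partial>count_space (N m'))" for m'
      unfolding J_def by (rule nn_integral_cmult) simp
    then show "(\<Sum>m'\<in>UNIV. \<integral>\<^sup>+s. J m' p k s \<partial>count_space (N m')) = ennreal (hfun P (Inl m) (Inr p) (t - k)) *
        (\<Sum>m'\<in>UNIV. \<integral>\<^sup>+s\<in>ico t0 k. Y_pt P m' t0 s p k \<partial>count_space (N m')) * indicator (ico t0 t) k"
      by (simp only: sum_distrib_left[symmetric] mult_ac)
  qed
  finally show ?thesis .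
qed

text \<open>The formula for \<open>W\<close> is inserted into the intensity. Equality is stated in
  \<open>ereal\<close> because \<open>ennreal\<close> sends negative numbers to 0 and would hide the
  sign, which is therefore carried along with each value of \<open>W\<close>.\<close>

lemma cluster_representation:
  assumes conv: "har_input_converges P t0 N W (Inl m) t"
    and W: "\<And>p k. k \<in> grid P p \<Longrightarrow> t0 \<le> ereal k \<Longrightarrow> 0 \<le> W p k \<and> ennreal (W p k) = Y_total x N t0 p k"
  shows "ereal (base P m + har_input P t0 N W (Inl m) t) = enn2ereal (immigrant_rate P x m t0 t +
           (\<Sum>m'\<in>UNIV. \<integral>\<^sup>+ s\<in>ico t0 t. cluster_kernel P m m' s t \<partial>count_space (N m')))"
proof -
  have W_nn: "0 \<le> W p k" if "k \<in> grid P p" "k \<in> ico t0 t" for p k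
    using W that by (simp add: ico_def)
  have nonneg: "0 \<le> har_input P t0 N W (Inl m) t"
    using conv W_nn by (rule ennreal_har_input)
  have input: "ennreal (har_input P t0 N W (Inl m) t) =
      (\<Sum>m'\<in>UNIV. \<integral>\<^sup>+s\<in>ico t0 t. ennreal (hfun P (Inl m) (Inl m') (t - s)) \<partial>count_space (N m')) +
      (\<Sum>p\<in>UNIV. \<integral>\<^sup>+k\<in>ico t0 t. (ennreal (hfun P (Inl m) (Inr p) (t - k)) * ennreal (W p k) +
         ennreal (bfun P (Inl m) p (t - k))) \<partial>count_space (grid P p))"
    using conv W_nn by (rule ennreal_har_input)
  have W_val: "(\<integral>\<^sup>+k\<in>ico t0 t. (ennreal (hfun P (Inl m) (Inr p) (t - k)) * ennreal (W p k) +
         ennreal (bfun P (Inl m) p (t - k))) \<partial>count_space (grid P p)) =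
       (\<integral>\<^sup>+ k\<in>ico t0 t. (ennreal (hfun P (Inl m) (Inr p) (t - k)) * (Y_b P t0 p k + Y_xi P x t0 p k) +
         ennreal (bfun P (Inl m) p (t - k))) \<partial>count_space (grid P p)) +
       (\<integral>\<^sup>+k\<in>ico t0 t. ennreal (hfun P (Inl m) (Inr p) (t - k)) *
          (\<Sum>m'\<in>UNIV. \<integral>\<^sup>+s\<in>ico t0 k. Y_pt P m' t0 s p k \<partial>count_space (N m')) \<partial>count_space (grid P p))" for p
    using W
    by (subst nn_integral_add[symmetric])
       (auto simp: Y_total_def ico_def distrib_left add_ac intro!: nn_integral_cong split: split_indicator)
  have "ennreal (base P m + har_input P t0 N W (Inl m) t) = immigrant_rate P x m t0 t +
           (\<Sum>m'\<in>UNIV. \<integral>\<^sup>+ s\<in>ico t0 t. cluster_kernel P m m' s t \<partial>count_space (N m'))"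
    unfolding ennreal_plus[OF base_nonneg nonneg] input W_val sum.distrib
      sum_nn_integral_cluster_kernel immigrant_rate_def
    by (simp only: add_ac)
  moreover have "0 \<le> base P m + har_input P t0 N W (Inl m) t"
    using nonneg base_nonneg by simp
  ultimately show ?thesis
    by (metis enn2ereal_ennreal)
qed

end

section \<open>Restarting the recursion at a real time, for a fixed realization\<close>

lemma set_integrable_count_space_subset:
  fixes f :: "'b \<Rightarrow> real"
  assumes "set_integrable (count_space X) A f" "B \<subseteq> A"
  shows "set_integrable (count_space X) B f"
  using assms(1) unfolding set_integrable_def
  by (rule Bochner_Integration.integrable_bound)
     (use assms(2) in \<open>auto intro!: AE_I2 split: split_indicator\<close>)

lemma set_integrable_count_space_finite:
  fixes f :: "'b \<Rightarrow> real"
  assumes "finite (X \<inter> A)"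
  shows "set_integrable (count_space X) A f"
  unfolding set_integrable_def
proof (rule integrableI_bounded)
  have "(\<integral>\<^sup>+x. ennreal (norm (indicator A x *\<^sub>R f x)) \<partial>count_space X) =
      (\<Sum>x\<in>X \<inter> A. ennreal (norm (indicator A x *\<^sub>R f x)))"
    using assms by (intro nn_integral_count_space') (auto split: split_indicator)
  also have "\<dots> < \<infinity>"
    by simp
  finally show "(\<integral>\<^sup>+x. ennreal (norm (indicator A x *\<^sub>R f x)) \<partial>count_space X) < \<infinity>" .
qed simp

lemma set_integral_count_space_finite:
  fixes f :: "'b \<Rightarrow> real"
  assumes "finite (X \<inter> A)"
  shows "(LINT x:A|count_space X. f x) = (\<Sum>x\<in>X \<inter> A. f x)"
proof -
  have fin: "finite {x \<in> X. indicator A x *\<^sub>R f x \<noteq> 0}"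
    by (rule finite_subset[OF _ assms]) (auto split: split_indicator_asm)
  have "(LINT x:A|count_space X. f x) = (\<Sum>x | x \<in> X \<and> indicator A x *\<^sub>R f x \<noteq> 0. indicator A x *\<^sub>R f x)"
    unfolding set_lebesgue_integral_def by (rule lebesgue_integral_count_space_finite_support[OF fin])
  also have "\<dots> = (\<Sum>x\<in>X \<inter> A. f x)"
    using assms by (intro sum.mono_neutral_cong_left) (auto split: split_indicator_asm)
  finally show ?thesis .
qed

lemma grid_resolvent_add:
  "grid_resolvent P a (\<lambda>p k. F p k + G p k) p k = grid_resolvent P a F p k + grid_resolvent P a G p k"
  by (simp add: grid_resolvent_def distrib_left sum.distrib)

lemma (in linear_parameters) ennreal_grid_resolvent:
  assumes F: "\<And>q l. l \<in> grid P q \<Longrightarrow> a \<le> l \<Longrightarrow> 0 \<le> F q l"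
  shows "ennreal (grid_resolvent P a F p k) =
    (\<Sum>q\<in>UNIV. \<integral>\<^sup>+l\<in>{a..k}. ennreal (coef P p k q l) * ennreal (F q l) \<partial>count_space (grid P q))"
    and "0 \<le> grid_resolvent P a F p k"
proof -
  have nn: "0 \<le> coef P p k q l * F q l" if "l \<in> grid P q" "a \<le> l" "l \<le> k" for q l
    using that by (intro mult_nonneg_nonneg coef_nonneg' F)
  have nn_sum: "0 \<le> (\<Sum>l\<in>grid P q \<inter> {a..k}. coef P p k q l * F q l)" for q
    using nn by (intro sum_nonneg) auto
  then show "0 \<le> grid_resolvent P a F p k"
    unfolding grid_resolvent_def by (rule sum_nonneg)
  have "ennreal (grid_resolvent P a F p k) =
      (\<Sum>q\<in>UNIV. ennreal (\<Sum>l\<in>grid P q \<inter> {a..k}. coef P p k q l * F q l))"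
    unfolding grid_resolvent_def using nn_sum by (intro sum_ennreal[symmetric])
  also have "\<dots> = (\<Sum>q\<in>UNIV. \<integral>\<^sup>+l\<in>{a..k}. ennreal (coef P p k q l * F q l) \<partial>count_space (grid P q))"
    using nn by (simp add: nn_integral_grid_eq_sum)
  finally show "ennreal (grid_resolvent P a F p k) =
      (\<Sum>q\<in>UNIV. \<integral>\<^sup>+l\<in>{a..k}. ennreal (coef P p k q l) * ennreal (F q l) \<partial>count_space (grid P q))"
    by (simp add: ennreal_mult' coef_nonneg')
qed

text \<open>A majorant for what the grid values before \<open>a\<close> contribute at
  \<open>(p, k)\<close>. Absolute values are taken since the sign of \<open>W\<close> is still
  unknown; \<open>l\<close> runs over the whole grid, so that only the constraint on
  \<open>l'\<close> moves with \<open>a\<close>.\<close>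

definition (in linear_parameters) past_bound :: "('p \<Rightarrow> real \<Rightarrow> real) \<Rightarrow> real \<Rightarrow> 'p \<Rightarrow> real \<Rightarrow> ennreal" where
  "past_bound W a p k = (\<Sum>q\<in>UNIV. \<integral>\<^sup>+l. ennreal (coef P p k q l) *
     (\<Sum>q'\<in>UNIV. \<integral>\<^sup>+l'\<in>{..<a}. ennreal (hfun P (Inr q) (Inr q') (l - l')) * ennreal \<bar>W q' l'\<bar>
        \<partial>count_space (grid P q')) \<partial>count_space (grid P q))"

text \<open>One outcome outside the exceptional null sets. \<open>b_conv\<close> is separate from
  \<open>conv\<close>, which only controls the \<open>W\<close> and \<open>b\<close> parts together;
  with \<open>W\<close> of unknown sign this does not bound either part alone.\<close>

locale har_realization = linear_parameters P
  for P :: "('m::finite, 'p::finite) har_params" +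
  fixes t0 :: ereal and N :: "'m \<Rightarrow> real set" and W x :: "'p \<Rightarrow> real \<Rightarrow> real"
  assumes x_nonneg: "k \<in> grid P p \<Longrightarrow> t0 \<le> ereal k \<Longrightarrow> 0 \<le> x p k"
    and conv: "k \<in> grid P p \<Longrightarrow> t0 \<le> ereal k \<Longrightarrow> har_input_converges P t0 N W (Inr p) k"
    and W_eq: "k \<in> grid P p \<Longrightarrow> t0 \<le> ereal k \<Longrightarrow> W p k = x p k + har_input P t0 N W (Inr p) k"
    and b_conv: "k \<in> grid P p \<Longrightarrow> t0 \<le> ereal k \<Longrightarrow>
      set_integrable (count_space (grid P q)) (ico t0 k) (\<lambda>l. bfun P (Inr p) q (k - l))"
begin

text \<open>The input that involves no grid values. It reaches back to \<open>t0\<close> rather than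
  to the restart time, and so is the same for every restart.\<close>

definition free_term :: "'p \<Rightarrow> real \<Rightarrow> real" where
  "free_term p k = x p k +
     ((\<Sum>m\<in>UNIV. LINT s:ico t0 k|count_space (N m). hfun P (Inr p) (Inl m) (k - s)) +
      (\<Sum>q\<in>UNIV. LINT l:ico t0 k|count_space (grid P q). bfun P (Inr p) q (k - l)))"

definition past_term :: "real \<Rightarrow> 'p \<Rightarrow> real \<Rightarrow> real" where
  "past_term a p k =
     (\<Sum>q\<in>UNIV. LINT l:ico t0 a|count_space (grid P q). hfun P (Inr p) (Inr q) (k - l) * W q l)"

lemma W_conv:
  assumes "k \<in> grid P p" "t0 \<le> ereal k"
  shows "set_integrable (count_space (grid P q)) (ico t0 k) (\<lambda>l. hfun P (Inr p) (Inr q) (k - l) * W q l)"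
proof -
  have "set_integrable (count_space (grid P q)) (ico t0 k)
      (\<lambda>l. (hfun P (Inr p) (Inr q) (k - l) * W q l + bfun P (Inr p) q (k - l)) - bfun P (Inr p) q (k - l))"
    using conv[OF assms] b_conv[OF assms] unfolding har_input_converges_def
    by (intro set_integral_diff) auto
  then show ?thesis
    by simp
qed

lemma W_eq_free_term:
  assumes k: "k \<in> grid P p" "a \<le> k" and a: "t0 \<le> ereal a"
  shows "W p k = (free_term p k + past_term a p k) + grid_convolution P a W p k"
proof -
  have t0k: "t0 \<le> ereal k"
    using k(2) a by (meson ereal_less_eq(3) order_trans)
  have ico: "ico t0 k = ico t0 a \<union> {a..<k}"
    using k(2) a by (auto simp: ico_def) (meson ereal_less_eq(3) order_trans)
  have "(LINT l:ico t0 k|count_space (grid P q). hfun P (Inr p) (Inr q) (k - l) * W q l + bfun P (Inr p) q (k - l)) =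
      (LINT l:ico t0 a|count_space (grid P q). hfun P (Inr p) (Inr q) (k - l) * W q l) +
      (\<Sum>l\<in>grid P q \<inter> {a..<k}. hfun P (Inr p) (Inr q) (k - l) * W q l) +
      (LINT l:ico t0 k|count_space (grid P q). bfun P (Inr p) q (k - l))" for q
  proof -
    have "(LINT l:ico t0 k|count_space (grid P q). hfun P (Inr p) (Inr q) (k - l) * W q l) =
        (LINT l:ico t0 a|count_space (grid P q). hfun P (Inr p) (Inr q) (k - l) * W q l) +
        (LINT l:{a..<k}|count_space (grid P q). hfun P (Inr p) (Inr q) (k - l) * W q l)"
      unfolding ico using W_conv[OF k(1) t0k, unfolded ico, of q]
      by (intro set_integral_Un) (auto simp: ico_def intro: set_integrable_count_space_subset)
    then show ?thesis
      using W_conv[OF k(1) t0k] b_conv[OF k(1) t0k]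
      by (simp add: set_integral_add set_integral_count_space_finite finite_grid_Int)
  qed
  then show ?thesis
    by (simp add: W_eq[OF k(1) t0k] har_input_def free_term_def past_term_def grid_convolution_def
        sum.distrib add_ac)
qed

lemma W_eq_grid_resolvent:
  assumes "k \<in> grid P p" "a \<le> k" "t0 \<le> ereal a"
  shows "W p k = grid_resolvent P a free_term p k + grid_resolvent P a (past_term a) p k"
  unfolding grid_resolvent_add[symmetric]
  using assms by (intro grid_resolvent_unique W_eq_free_term)

lemma free_term_nonneg: "0 \<le> free_term p k"
  and ennreal_free_term: "ennreal (free_term p k) = ennreal (x p k) +
     ((\<Sum>m\<in>UNIV. \<integral>\<^sup>+s\<in>ico t0 k. ennreal (hfun P (Inr p) (Inl m) (k - s)) \<partial>count_space (N m)) +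
      (\<Sum>q\<in>UNIV. \<integral>\<^sup>+l\<in>ico t0 k. ennreal (bfun P (Inr p) q (k - l)) \<partial>count_space (grid P q)))"
  if k: "k \<in> grid P p" "t0 \<le> ereal k"
proof -
  have N_int: "set_integrable (count_space (N m)) (ico t0 k) (\<lambda>s. hfun P (Inr p) (Inl m) (k - s))" for m
    using conv[OF k] by (auto simp: har_input_converges_def)
  note N_val = ennreal_set_integral[OF N_int hfun_nonneg]
  note b_val = ennreal_set_integral[OF b_conv[OF k] bfun_nonneg]
  show "0 \<le> free_term p k"
    unfolding free_term_def by (intro add_nonneg_nonneg sum_nonneg x_nonneg k N_val(2) b_val(2))
  show "ennreal (free_term p k) = ennreal (x p k) +
     ((\<Sum>m\<in>UNIV. \<integral>\<^sup>+s\<in>ico t0 k. ennreal (hfun P (Inr p) (Inl m) (k - s)) \<partial>count_space (N m)) +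
      (\<Sum>q\<in>UNIV. \<integral>\<^sup>+l\<in>ico t0 k. ennreal (bfun P (Inr p) q (k - l)) \<partial>count_space (grid P q)))"
    unfolding free_term_def N_val(1)[symmetric] b_val(1)[symmetric]
    using N_val(2) b_val(2) x_nonneg[OF k] by (simp add: sum_nonneg)
qed

text \<open>\<open>Y_b\<close>, \<open>Y_xi\<close> and the point part are the coefficient sums of
  the three pieces of \<open>free_term\<close>; for the points this is
  \<open>sum_nn_integral_Y_pt\<close>.\<close>

lemma Y_total_eq:
  "Y_total x N t0 p k =
   (\<Sum>q\<in>UNIV. \<integral>\<^sup>+l\<in>icc t0 k. ennreal (coef P p k q l) * ennreal (free_term q l) \<partial>count_space (grid P q))"
proof -
  have "(\<integral>\<^sup>+l\<in>icc t0 k. ennreal (coef P p k q l) * ennreal (free_term q l) \<partial>count_space (grid P q)) =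
      (\<integral>\<^sup>+l. ennreal (coef P p k q l) * (\<Sum>q'\<in>UNIV. \<integral>\<^sup>+ k''\<in>ico t0 l. ennreal (bfun P (Inr q) q' (l - k''))
           \<partial>count_space (grid P q')) * indicator (icc t0 k) l +
        (ennreal (coef P p k q l) * ennreal (x q l) * indicator (icc t0 k) l +
        ennreal (coef P p k q l) * (\<Sum>m\<in>UNIV. \<integral>\<^sup>+s\<in>ico t0 l. ennreal (hfun P (Inr q) (Inl m) (l - s))
           \<partial>count_space (N m)) * indicator (icc t0 k) l) \<partial>count_space (grid P q))" for q
  proof (intro nn_integral_cong)
    fix l assume "l \<in> space (count_space (grid P q))"
    then show "ennreal (coef P p k q l) * ennreal (free_term q l) * indicator (icc t0 k) l =
      ennreal (coef P p k q l) * (\<Sum>q'\<in>UNIV. \<integral>\<^sup>+ k''\<in>ico t0 l. ennreal (bfun P (Inr q) q' (l - k''))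
           \<partial>count_space (grid P q')) * indicator (icc t0 k) l +
        (ennreal (coef P p k q l) * ennreal (x q l) * indicator (icc t0 k) l +
        ennreal (coef P p k q l) * (\<Sum>m\<in>UNIV. \<integral>\<^sup>+s\<in>ico t0 l. ennreal (hfun P (Inr q) (Inl m) (l - s))
           \<partial>count_space (N m)) * indicator (icc t0 k) l)"
      by (cases "l \<in> icc t0 k") (auto simp: icc_def ennreal_free_term distrib_left add_ac)
  qed
  then show ?thesis
    by (simp add: Y_total_def Y_b_def Y_xi_def sum_nn_integral_Y_pt nn_integral_add sum.distrib add_ac)
qed

lemma free_term_nonneg_from:
  assumes "t0 \<le> ereal a" "l \<in> grid P q" "a \<le> l"
  shows "0 \<le> free_term q l"
  using assms by (intro free_term_nonneg) (meson ereal_less_eq(3) order_trans)+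

lemma truncated_Y_total:
  assumes "t0 \<le> ereal a"
  shows "ennreal (grid_resolvent P a free_term p k) =
    (\<Sum>q\<in>UNIV. \<integral>\<^sup>+l\<in>{a..k}. ennreal (coef P p k q l) * ennreal (free_term q l) \<partial>count_space (grid P q))"
    and "0 \<le> grid_resolvent P a free_term p k"
  by (rule ennreal_grid_resolvent, rule free_term_nonneg_from[OF assms], assumption+)+

text \<open>A restart at \<open>a = t0\<close> has no past, so the finite resolvent is already the
  whole formula.\<close>

lemma W_eq_Y_total_finite_start:
  assumes k: "k \<in> grid P p" "t0 \<le> ereal k" and t0: "t0 = ereal a"
  shows "0 \<le> W p k \<and> ennreal (W p k) = Y_total x N t0 p k"
proof -
  have ak: "a \<le> k"
    using k t0 by simp
  have t0_le: "t0 \<le> ereal a"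
    by (simp add: t0)
  have "ico t0 a = {}"
    by (auto simp: ico_def t0)
  then have "past_term a = (\<lambda>p k. 0)"
    by (auto simp: past_term_def fun_eq_iff set_lebesgue_integral_def)
  then have "grid_resolvent P a (past_term a) p k = 0"
    by (simp add: grid_resolvent_def)
  then have "W p k = grid_resolvent P a free_term p k"
    using W_eq_grid_resolvent[OF k(1) ak t0_le] by simp
  moreover have "icc t0 k = {a..k}"
    by (auto simp: icc_def t0)
  ultimately show ?thesis
    using truncated_Y_total[of a p k] t0_le by (simp add: Y_total_eq)
qed

lemma abs_grid_resolvent_past_term_le:
  assumes a: "t0 \<le> ereal a"
  shows "ennreal \<bar>grid_resolvent P a (past_term a) p k\<bar> \<le> past_bound W a p k"
proof -
  have past: "ennreal \<bar>past_term a q l\<bar> \<le>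
      (\<Sum>q'\<in>UNIV. \<integral>\<^sup>+l'\<in>{..<a}. ennreal (hfun P (Inr q) (Inr q') (l - l')) * ennreal \<bar>W q' l'\<bar>
        \<partial>count_space (grid P q'))" if l: "l \<in> grid P q" "a \<le> l" for q l
  proof -
    have t0l: "t0 \<le> ereal l"
      using a l by (meson ereal_less_eq(3) order_trans)
    have int: "set_integrable (count_space (grid P q')) (ico t0 a) (\<lambda>l'. hfun P (Inr q) (Inr q') (l - l') * W q' l')" for q'
      using W_conv[OF l(1) t0l] by (rule set_integrable_count_space_subset) (use l in \<open>auto simp: ico_def\<close>)
    have "ennreal \<bar>past_term a q l\<bar> \<le>
        ennreal (\<Sum>q'\<in>UNIV. \<bar>LINT l':ico t0 a|count_space (grid P q'). hfun P (Inr q) (Inr q') (l - l') * W q' l'\<bar>)"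
      unfolding past_term_def by (intro ennreal_leI sum_abs)
    also have "\<dots> = (\<Sum>q'\<in>UNIV. ennreal \<bar>LINT l':ico t0 a|count_space (grid P q'). hfun P (Inr q) (Inr q') (l - l') * W q' l'\<bar>)"
      by (simp add: sum_ennreal)
    also have "\<dots> \<le> (\<Sum>q'\<in>UNIV. \<integral>\<^sup>+l'\<in>ico t0 a. ennreal \<bar>hfun P (Inr q) (Inr q') (l - l') * W q' l'\<bar> \<partial>count_space (grid P q'))"
      by (intro sum_mono ennreal_abs_set_integral_le int)
    also have "\<dots> \<le> (\<Sum>q'\<in>UNIV. \<integral>\<^sup>+l'\<in>{..<a}. ennreal (hfun P (Inr q) (Inr q') (l - l')) * ennreal \<bar>W q' l'\<bar>
        \<partial>count_space (grid P q'))"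
      by (intro sum_mono nn_integral_mono)
         (auto simp: ico_def abs_mult hfun_nonneg ennreal_mult split: split_indicator)
    finally show ?thesis .
  qed
  have "ennreal \<bar>grid_resolvent P a (past_term a) p k\<bar> \<le>
      ennreal (\<Sum>q\<in>UNIV. \<Sum>l\<in>grid P q \<inter> {a..k}. coef P p k q l * \<bar>past_term a q l\<bar>)"
    unfolding grid_resolvent_def
    by (intro ennreal_leI order_trans[OF sum_abs] sum_mono) (simp add: abs_mult coef_nonneg' order_trans[OF sum_abs])
  also have "\<dots> = (\<Sum>q\<in>UNIV. \<integral>\<^sup>+l\<in>{a..k}. ennreal (coef P p k q l) * ennreal \<bar>past_term a q l\<bar> \<partial>count_space (grid P q))"
    unfolding grid_resolvent_def[symmetric] by (rule ennreal_grid_resolvent) simp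
  also have "\<dots> \<le> past_bound W a p k"
    unfolding past_bound_def using past
    by (intro sum_mono nn_integral_mono) (auto intro!: mult_left_mono split: split_indicator)
  finally show ?thesis .
qed

text \<open>\<open>W p k = S n + R n\<close> for large \<open>n\<close>, with \<open>S\<close>
  nonnegative and increasing and \<open>R\<close> small infinitely often. Hence \<open>S\<close>
  converges to \<open>W p k\<close>, while monotone convergence sends it to
  \<open>Y_total\<close>.\<close>

lemma W_eq_Y_total_infinite_start:
  assumes k: "k \<in> grid P p" and t0: "t0 = -\<infinity>"
    and past: "liminf (\<lambda>n. past_bound W (- real n) p k) = 0"
  shows "0 \<le> W p k \<and> ennreal (W p k) = Y_total x N t0 p k"
proof -
  define S where "S n = grid_resolvent P (- real n) free_term p k" for n
  define R where "R n = grid_resolvent P (- real n) (past_term (- real n)) p k" for n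
  obtain n0 where n0: "- real n \<le> k" if "n0 \<le> n" for n
  proof -
    obtain n0 where "- k \<le> real n0"
      using real_arch_simple by blast
    then show thesis
      by (intro that[of n0]) (meson minus_le_iff of_nat_le_iff order_trans)
  qed
  have W: "W p k = S n + R n" if "n0 \<le> n" for n
    unfolding S_def R_def using k n0[OF that] t0 by (intro W_eq_grid_resolvent) auto
  have S_nonneg: "0 \<le> S n" for n
    unfolding S_def by (rule truncated_Y_total(2)) (simp add: t0)
  have t0_le: "t0 \<le> ereal a" for a
    by (simp add: t0)
  have free_nn: "0 \<le> free_term q l" if "l \<in> grid P q" for q l
    using that by (rule free_term_nonneg) (simp add: t0)
  have S_mono: "S n \<le> S n'" if "n \<le> n'" for n n'
    unfolding S_def grid_resolvent_def using that
    by (intro sum_mono sum_mono2 finite_grid_atLeastAtMost)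
       (auto intro: mult_nonneg_nonneg[OF coef_nonneg' free_nn])
  \<comment> \<open>Only the lower limit of the bound vanishes, so \<open>R n\<close> is small for
    arbitrarily late \<open>n\<close>, not for all late \<open>n\<close>.\<close>
  have small: "\<exists>n\<ge>n1. \<bar>R n\<bar> < e" if e: "0 < e" for e n1
  proof (rule ccontr)
    assume contr: "\<not> (\<exists>n\<ge>n1. \<bar>R n\<bar> < e)"
    have "eventually (\<lambda>n. ennreal e \<le> past_bound W (- real n) p k) sequentially"
      unfolding eventually_sequentially
    proof (intro exI[of _ n1] allI impI)
      fix n assume "n1 \<le> n"
      then have "ennreal e \<le> ennreal \<bar>R n\<bar>"
        using contr by (intro ennreal_leI) (auto simp: not_less)
      also have "\<dots> \<le> past_bound W (- real n) p k"
        unfolding R_def by (rule abs_grid_resolvent_past_term_le) (simp add: t0)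
      finally show "ennreal e \<le> past_bound W (- real n) p k" .
    qed
    then have "ennreal e \<le> liminf (\<lambda>n. past_bound W (- real n) p k)"
      by (rule Liminf_bounded)
    then show False
      using past e by (simp add: ennreal_eq_0_iff)
  qed
  have "S \<longlonglongrightarrow> W p k"
  proof (rule LIMSEQ_I)
    fix e :: real assume e: "0 < e"
    obtain n1 where n1: "n0 \<le> n1" "\<bar>R n1\<bar> < e"
      using small[OF e, of n0] by auto
    have "norm (S n - W p k) < e" if n: "n1 \<le> n" for n
    proof -
      \<comment> \<open>The good index \<open>n1\<close> bounds \<open>S n\<close> from below and a
        later good index \<open>n2\<close> from above; monotonicity covers all \<open>n\<close> in
        between.\<close>
      obtain n2 where n2: "n \<le> n2" "\<bar>R n2\<bar> < e"
        using small[OF e, of n] by auto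
      have "W p k - e < S n1" "S n1 \<le> S n" "S n \<le> S n2" "S n2 < W p k + e"
        using W[of n1] W[of n2] n1 n2 n S_mono[OF n] S_mono[OF n2(1)] by auto
      then show ?thesis
        by auto
    qed
    then show "\<exists>n0. \<forall>n\<ge>n0. norm (S n - W p k) < e"
      by blast
  qed
  then have lim: "(\<lambda>n. ennreal (S n)) \<longlonglongrightarrow> ennreal (W p k)"
    by (rule tendsto_ennrealI)
  have "(\<lambda>n. \<Sum>q\<in>UNIV. \<integral>\<^sup>+l\<in>{- real n..}. (ennreal (coef P p k q l) * ennreal (free_term q l) * indicator (icc t0 k) l)
      \<partial>count_space (grid P q)) \<longlonglongrightarrow> Y_total x N t0 p k"
    unfolding Y_total_eq by (intro tendsto_sum nn_integral_atLeast_LIMSEQ)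
  moreover have "(\<integral>\<^sup>+l\<in>{- real n..}. (ennreal (coef P p k q l) * ennreal (free_term q l) * indicator (icc t0 k) l)
      \<partial>count_space (grid P q)) = (\<integral>\<^sup>+l\<in>{- real n..k}. ennreal (coef P p k q l) * ennreal (free_term q l)
      \<partial>count_space (grid P q))" for n q
    by (intro nn_integral_cong) (auto simp: icc_def t0 split: split_indicator)
  ultimately have "(\<lambda>n. ennreal (S n)) \<longlonglongrightarrow> Y_total x N t0 p k"
    unfolding S_def by (simp add: truncated_Y_total(1)[OF t0_le])
  then have "ennreal (W p k) = Y_total x N t0 p k"
    using lim LIMSEQ_unique by blast
  moreover have "0 \<le> W p k"
    using \<open>S \<longlonglongrightarrow> W p k\<close> S_nonneg by (intro LIMSEQ_le_const) auto
  ultimately show ?thesis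
    by simp
qed

end

section \<open>Forgetting the infinite past\<close>

text \<open>Dominated convergence twice: the inner sums are dominated by \<open>hfun\<close>, whose
  grid sums are at most entries of \<open>H_WW\<close>, and the outer ones by the coefficients times
  the row sum \<open>K q\<close>, with total at most \<open>H_inv p q * K q\<close>.\<close>

lemma (in subcritical) past_influence_tendsto_0:
  assumes k: "k \<in> grid P p"
  shows "(\<lambda>n. \<Sum>q\<in>UNIV. \<integral>\<^sup>+l. ennreal (coef P p k q l) *
     (\<Sum>q'\<in>UNIV. \<integral>\<^sup>+l'\<in>{..<- real n}. ennreal (hfun P (Inr q) (Inr q') (l - l')) \<partial>count_space (grid P q'))
     \<partial>count_space (grid P q)) \<longlonglongrightarrow> 0"
proof -
  define D where "D n q l = (\<Sum>q'\<in>UNIV. \<integral>\<^sup>+l'\<in>{..<- real n}. ennreal (hfun P (Inr q) (Inr q') (l - l'))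
      \<partial>count_space (grid P q'))" for n q l
  define K where "K q = (\<Sum>q'\<in>UNIV. H_WW P q q')" for q
  have fin: "H_WW P q q' < \<infinity>" for q q'
    using spr by (simp add: spr_less_one_def)
  have h_le: "(\<integral>\<^sup>+l'. ennreal (hfun P (Inr q) (Inr q') (l - l')) \<partial>count_space (grid P q')) \<le> H_WW P q q'" for q q' l
    unfolding H_WW_def by (rule nn_integral_hfun_grid_le)
  have D_le: "D n q l \<le> K q" for n q l
    unfolding D_def K_def
    by (intro sum_mono order_trans[OF nn_integral_mono h_le]) (auto split: split_indicator)
  have D_lim: "(\<lambda>n. D n q l) \<longlonglongrightarrow> 0" for q l
  proof -
    have "(\<lambda>n. \<integral>\<^sup>+l'\<in>{..<- real n}. ennreal (hfun P (Inr q) (Inr q') (l - l')) \<partial>count_space (grid P q'))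
        \<longlonglongrightarrow> (\<integral>\<^sup>+l'. 0 \<partial>count_space (grid P q'))" for q'
    proof (rule nn_integral_dominated_convergence)
      show "(\<integral>\<^sup>+l'. ennreal (hfun P (Inr q) (Inr q') (l - l')) \<partial>count_space (grid P q')) < \<infinity>"
        using h_le fin by (rule le_less_trans)
      show "AE l' in count_space (grid P q').
          (\<lambda>n. ennreal (hfun P (Inr q) (Inr q') (l - l')) * indicator {..<- real n} l') \<longlonglongrightarrow> 0"
      proof (intro AE_I2 tendsto_eventually)
        fix l' :: real
        have "eventually (\<lambda>n. - l' \<le> real n) sequentially"
          by real_asymp
        then show "eventually (\<lambda>n. ennreal (hfun P (Inr q) (Inr q') (l - l')) * indicator {..<- real n} l' = 0) sequentially"
          by eventually_elim (auto split: split_indicator)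
      qed
    qed (auto split: split_indicator)
    then have "(\<lambda>n. D n q l) \<longlonglongrightarrow> (\<Sum>q'\<in>UNIV. \<integral>\<^sup>+l'. 0 \<partial>count_space (grid P q'))"
      unfolding D_def by (rule tendsto_sum)
    then show ?thesis
      by simp
  qed
  have "(\<lambda>n. \<integral>\<^sup>+l. ennreal (coef P p k q l) * D n q l \<partial>count_space (grid P q)) \<longlonglongrightarrow> (\<integral>\<^sup>+l. 0 \<partial>count_space (grid P q))" for q
  proof (rule nn_integral_dominated_convergence)
    have "(\<integral>\<^sup>+l. ennreal (coef P p k q l) * K q \<partial>count_space (grid P q)) \<le> ennreal (H_inv p q) * K q"
      using nn_integral_coef_le[OF k, of q] by (simp add: nn_integral_multc mult_right_mono)
    also have "\<dots> < \<infinity>"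
      using fin by (simp add: K_def ennreal_mult_less_top)
    finally show "(\<integral>\<^sup>+l. ennreal (coef P p k q l) * K q \<partial>count_space (grid P q)) < \<infinity>" .
    show "AE l in count_space (grid P q). (\<lambda>n. ennreal (coef P p k q l) * D n q l) \<longlonglongrightarrow> 0"
    proof (rule AE_I2)
      fix l
      show "(\<lambda>n. ennreal (coef P p k q l) * D n q l) \<longlonglongrightarrow> 0"
        using ennreal_tendsto_cmult[OF _ D_lim[of q l], of "ennreal (coef P p k q l)"] by simp
    qed
  qed (auto intro!: mult_left_mono D_le)
  then have "(\<lambda>n. \<Sum>q\<in>UNIV. \<integral>\<^sup>+l. ennreal (coef P p k q l) * D n q l \<partial>count_space (grid P q)) \<longlonglongrightarrow>
      (\<Sum>q\<in>UNIV. \<integral>\<^sup>+l. 0 \<partial>count_space (grid P q))"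
    by (rule tendsto_sum)
  then show ?thesis
    by (simp add: D_def)
qed

lemma (in linear_parameters) borel_measurable_past_bound:
  assumes "\<And>q l. l \<in> grid P q \<Longrightarrow> W q l \<in> borel_measurable M"
  shows "(\<lambda>\<omega>. past_bound (\<lambda>q l. W q l \<omega>) a p k) \<in> borel_measurable M"
  unfolding past_bound_def
  by (intro borel_measurable_sum borel_measurable_nn_integral_count_space countable_grid
      borel_measurable_times_ennreal borel_measurable_const measurable_compose[OF _ measurable_ennreal]
      borel_measurable_abs assms)

text \<open>By Tonelli the uniform moment bound \<open>C\<close> factors out and leaves a
  deterministic quantity.\<close>

lemma (in linear_parameters) nn_integral_past_bound_le:
  assumes [measurable]: "\<And>q l. l \<in> grid P q \<Longrightarrow> W q l \<in> borel_measurable M"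
    and C: "\<And>q l. l \<in> grid P q \<Longrightarrow> (\<integral>\<^sup>+\<omega>. ennreal \<bar>W q l \<omega>\<bar> \<partial>M) \<le> C"
  shows "(\<integral>\<^sup>+\<omega>. past_bound (\<lambda>q l. W q l \<omega>) a p k \<partial>M) \<le>
    C * (\<Sum>q\<in>UNIV. \<integral>\<^sup>+l. ennreal (coef P p k q l) *
     (\<Sum>q'\<in>UNIV. \<integral>\<^sup>+l'\<in>{..<a}. ennreal (hfun P (Inr q) (Inr q') (l - l')) \<partial>count_space (grid P q'))
     \<partial>count_space (grid P q))"
proof -
  define V where "V q l q' \<omega> = (\<integral>\<^sup>+l'\<in>{..<a}. ennreal (hfun P (Inr q) (Inr q') (l - l')) * ennreal \<bar>W q' l' \<omega>\<bar>
        \<partial>count_space (grid P q'))" for q l q' \<omega>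
  have [measurable]: "V q l q' \<in> borel_measurable M" for q l q'
    unfolding V_def
    by (intro borel_measurable_nn_integral_count_space countable_grid) measurable
  have [measurable]: "(\<lambda>\<omega>. \<integral>\<^sup>+l. ennreal (coef P p k q l) * (\<Sum>q'\<in>UNIV. V q l q' \<omega>) \<partial>count_space (grid P q)) \<in> borel_measurable M" for q
    by (intro borel_measurable_nn_integral_count_space countable_grid) measurable
  have V_le: "(\<integral>\<^sup>+\<omega>. V q l q' \<omega> \<partial>M) \<le>
      C * (\<integral>\<^sup>+l'\<in>{..<a}. ennreal (hfun P (Inr q) (Inr q') (l - l')) \<partial>count_space (grid P q'))" for q l q'
  proof -
    have "(\<integral>\<^sup>+\<omega>. V q l q' \<omega> \<partial>M) = (\<integral>\<^sup>+l'. \<integral>\<^sup>+\<omega>. ennreal (hfun P (Inr q) (Inr q') (l - l')) * ennreal \<bar>W q' l' \<omega>\<bar> * indicator {..<a} l'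
        \<partial>M \<partial>count_space (grid P q'))"
      unfolding V_def by (intro nn_integral_count_space_nn_integral countable_grid) measurable
    also have "\<dots> \<le> (\<integral>\<^sup>+l'. C * (ennreal (hfun P (Inr q) (Inr q') (l - l')) * indicator {..<a} l') \<partial>count_space (grid P q'))"
    proof (intro nn_integral_mono)
      fix l' assume "l' \<in> space (count_space (grid P q'))"
      then have l': "l' \<in> grid P q'"
        by simp
      have "(\<integral>\<^sup>+\<omega>. ennreal (hfun P (Inr q) (Inr q') (l - l')) * ennreal \<bar>W q' l' \<omega>\<bar> * indicator {..<a} l' \<partial>M) =
          ennreal (hfun P (Inr q) (Inr q') (l - l')) * (\<integral>\<^sup>+\<omega>. ennreal \<bar>W q' l' \<omega>\<bar> \<partial>M) * indicator {..<a} l'"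
        using assms(1)[OF l'] by (simp add: nn_integral_multc nn_integral_cmult)
      also have "\<dots> \<le> ennreal (hfun P (Inr q) (Inr q') (l - l')) * C * indicator {..<a} l'"
        by (intro mult_right_mono mult_left_mono C l') auto
      finally show "(\<integral>\<^sup>+\<omega>. ennreal (hfun P (Inr q) (Inr q') (l - l')) * ennreal \<bar>W q' l' \<omega>\<bar> * indicator {..<a} l' \<partial>M) \<le>
          C * (ennreal (hfun P (Inr q) (Inr q') (l - l')) * indicator {..<a} l')"
        by (simp add: mult_ac)
    qed
    also have "\<dots> = C * (\<integral>\<^sup>+l'\<in>{..<a}. ennreal (hfun P (Inr q) (Inr q') (l - l')) \<partial>count_space (grid P q'))"
      by (rule nn_integral_cmult) simp
    finally show ?thesis .
  qed
  have "(\<integral>\<^sup>+\<omega>. past_bound (\<lambda>q l. W q l \<omega>) a p k \<partial>M) =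
      (\<Sum>q\<in>UNIV. \<integral>\<^sup>+l. \<integral>\<^sup>+\<omega>. ennreal (coef P p k q l) * (\<Sum>q'\<in>UNIV. V q l q' \<omega>) \<partial>M \<partial>count_space (grid P q))"
    unfolding past_bound_def V_def[symmetric]
    by (subst nn_integral_sum) (auto intro!: sum.cong nn_integral_count_space_nn_integral countable_grid)
  also have "\<dots> = (\<Sum>q\<in>UNIV. \<integral>\<^sup>+l. ennreal (coef P p k q l) * (\<Sum>q'\<in>UNIV. \<integral>\<^sup>+\<omega>. V q l q' \<omega> \<partial>M) \<partial>count_space (grid P q))"
    by (simp add: nn_integral_cmult nn_integral_sum)
  also have "\<dots> \<le> (\<Sum>q\<in>UNIV. \<integral>\<^sup>+l. ennreal (coef P p k q l) *
      (\<Sum>q'\<in>UNIV. C * (\<integral>\<^sup>+l'\<in>{..<a}. ennreal (hfun P (Inr q) (Inr q') (l - l')) \<partial>count_space (grid P q'))) \<partial>count_space (grid P q))"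
    by (intro sum_mono nn_integral_mono mult_left_mono V_le) simp
  also have "\<dots> = (\<Sum>q\<in>UNIV. \<integral>\<^sup>+l. C * (ennreal (coef P p k q l) *
      (\<Sum>q'\<in>UNIV. \<integral>\<^sup>+l'\<in>{..<a}. ennreal (hfun P (Inr q) (Inr q') (l - l')) \<partial>count_space (grid P q'))) \<partial>count_space (grid P q))"
    by (simp only: sum_distrib_left[symmetric] mult.left_commute)
  also have "\<dots> = C * (\<Sum>q\<in>UNIV. \<integral>\<^sup>+l. ennreal (coef P p k q l) *
     (\<Sum>q'\<in>UNIV. \<integral>\<^sup>+l'\<in>{..<a}. ennreal (hfun P (Inr q) (Inr q') (l - l')) \<partial>count_space (grid P q'))
     \<partial>count_space (grid P q))"
    by (subst nn_integral_cmult) (simp_all add: sum_distrib_left)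
  finally show ?thesis .
qed

lemma (in subcritical) AE_liminf_past_bound:
  assumes W: "\<And>q l. l \<in> grid P q \<Longrightarrow> W q l \<in> borel_measurable M"
    and C: "\<And>q l. l \<in> grid P q \<Longrightarrow> (\<integral>\<^sup>+\<omega>. ennreal \<bar>W q l \<omega>\<bar> \<partial>M) \<le> C" "C < \<infinity>"
    and k: "k \<in> grid P p"
  shows "AE \<omega> in M. liminf (\<lambda>n. past_bound (\<lambda>q l. W q l \<omega>) (- real n) p k) = 0"
proof -
  note [measurable] = borel_measurable_past_bound[OF W]
  define e where "e n = (\<Sum>q\<in>UNIV. \<integral>\<^sup>+l. ennreal (coef P p k q l) *
     (\<Sum>q'\<in>UNIV. \<integral>\<^sup>+l'\<in>{..<- real n}. ennreal (hfun P (Inr q) (Inr q') (l - l')) \<partial>count_space (grid P q'))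
     \<partial>count_space (grid P q))" for n
  have "(\<integral>\<^sup>+\<omega>. liminf (\<lambda>n. past_bound (\<lambda>q l. W q l \<omega>) (- real n) p k) \<partial>M) \<le>
      liminf (\<lambda>n. \<integral>\<^sup>+\<omega>. past_bound (\<lambda>q l. W q l \<omega>) (- real n) p k \<partial>M)"
    by (rule nn_integral_liminf) simp
  also have "\<dots> \<le> liminf (\<lambda>n. C * e n)"
    unfolding e_def by (intro Liminf_mono always_eventually allI nn_integral_past_bound_le W C(1))
  \<comment> \<open>The limit 0 survives multiplication because \<open>C\<close> is finite.\<close>
  also have "(\<lambda>n. C * e n) \<longlonglongrightarrow> C * 0"
    using past_influence_tendsto_0[OF k] C(2) unfolding e_def[symmetric]
    by (intro ennreal_tendsto_cmult) simp_all
  then have "liminf (\<lambda>n. C * e n) = 0"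
    by (simp add: lim_imp_Liminf)
  finally have "(\<integral>\<^sup>+\<omega>. liminf (\<lambda>n. past_bound (\<lambda>q l. W q l \<omega>) (- real n) p k) \<partial>M) = 0"
    by simp
  then show ?thesis
    by (subst (asm) nn_integral_0_iff_AE) auto
qed

section \<open>Linear HAR processes\<close>

text \<open>Grid values are controlled almost surely, intensities almost everywhere for the product
  measure; a null set of outcomes times the whole line is still null.\<close>

lemma AE_pair_lborel_fst:
  assumes "AE \<omega> in M. Q \<omega>"
  shows "AE z in M \<Otimes>\<^sub>M (lborel :: 'b::euclidean_space measure). Q (fst z)"
proof -
  obtain A where A: "A \<in> null_sets M" "{\<omega> \<in> space M. \<not> Q \<omega>} \<subseteq> A"
    using assms by (auto simp: eventually_ae_filter)
  have "A \<times> space lborel \<in> null_sets (M \<Otimes>\<^sub>M (lborel :: 'b measure))"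
    using A(1) by (intro lborel.times_in_null_sets1) auto
  then show ?thesis
    by (rule AE_I') (use A(2) in \<open>auto simp: space_pair_measure\<close>)
qed

text \<open>Tonelli and Fatou need measurability for \<open>M\<close>, while adaptedness speaks of
  the history. The generators of the history are events of \<open>M\<close>, by the measurability
  contained in \<open>indep_vars\<close> and \<open>poisson_random_measure\<close>.\<close>

lemma borel_measurable_history:
  assumes M: "prob_space M" and drifts: "linear_drifts M P \<xi>" and noise: "driving_noise M P \<pi> \<xi>"
    and f: "f \<in> borel_measurable (history M P \<pi> \<xi> t)"
  shows "f \<in> borel_measurable M"
proof -
  define G where "G = (\<Union>m. prm_events M (\<pi> m) ({..t} \<times> {0..})) \<union>
      (\<Union>(p, k)\<in>{(p, k). (p, k) \<in> grid_points P \<and> k \<le> t}. rv_events M (\<xi> p k))"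
  have "prm_events M (\<pi> m) S \<subseteq> sets M" for m S
  proof -
    have "(\<lambda>\<omega>. npts (\<pi> m \<omega> \<inter> A)) \<in> borel_measurable M" if "A \<in> sets borel" for A
      using noise that unfolding driving_noise_def poisson_random_measure_def by blast
    then show ?thesis
      by (auto simp: prm_events_def intro: measurable_sets)
  qed
  moreover have "rv_events M (\<xi> p k) \<subseteq> sets M" if "(p, k) \<in> grid_points P" for p k
  proof -
    have "\<forall>i\<in>grid_points P. (case i of (p, k) \<Rightarrow> \<xi> p k) \<in> borel_measurable M"
      using drifts unfolding linear_drifts_def prob_space.indep_vars_def[OF M] by blast
    then have "\<xi> p k \<in> borel_measurable M"
      using that by (auto dest!: bspec)
    then show ?thesis
      by (auto simp: rv_events_def intro: measurable_sets)
  qed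
  ultimately have G: "G \<subseteq> sets M"
    unfolding G_def by (intro Un_least UN_least) (simp_all split: prod.splits)
  have "G \<subseteq> Pow (space M)"
    using G sets.space_closed by blast
  then have hist: "space (history M P \<pi> \<xi> t) = space M" "sets (history M P \<pi> \<xi> t) = sigma_sets (space M) G"
    unfolding history_def G_def[symmetric] by (simp_all add: space_measure_of sets_measure_of)
  have "sigma_sets (space M) G \<subseteq> sets M"
    using G by (rule sets.sigma_sets_subset)
  then show ?thesis
    using f hist by (auto simp: measurable_def)
qed

context linear_parameters
begin

text \<open>Supplies \<open>b_conv\<close>: a real start leaves finitely many terms, and for
  \<open>-\<infinity>\<close> the amalgam norm bounds the sum.\<close>

lemma bfun_convergent:
  assumes t0: "t0 \<noteq> \<infinity>"
    and b: "t0 = -\<infinity> \<Longrightarrow> amalgam_norm (real (freq P q)) (bfun P \<alpha> q) < \<infinity>"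
  shows "set_integrable (count_space (grid P q)) (ico t0 k) (\<lambda>l. bfun P \<alpha> q (k - l))"
proof (cases t0)
  case (real a)
  then have "ico t0 k = {a..<k}"
    by (auto simp: ico_def)
  then show ?thesis
    by (simp add: set_integrable_count_space_finite finite_grid_Int)
next
  case PInf
  then show ?thesis
    using t0 by simp
next
  case MInf
  have "integrable (count_space (grid P q)) (\<lambda>l. bfun P \<alpha> q (k - l))"
  proof (rule integrableI_bounded)
    have "(\<integral>\<^sup>+l. ennreal (norm (bfun P \<alpha> q (k - l))) \<partial>count_space (grid P q)) \<le> amalgam_norm (real (freq P q)) (bfun P \<alpha> q)"
      using nn_integral_grid_le_amalgam_norm[OF freq_ge_1, of q "bfun P \<alpha> q" k] by simp
    then show "(\<integral>\<^sup>+l. ennreal (norm (bfun P \<alpha> q (k - l))) \<partial>count_space (grid P q)) < \<infinity>"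
      using b[OF MInf] by (rule le_less_trans)
  qed simp
  then have "set_integrable (count_space (grid P q)) UNIV (\<lambda>l. bfun P \<alpha> q (k - l))"
    by (simp add: set_integrable_def)
  then show ?thesis
    by (rule set_integrable_count_space_subset) simp
qed

lemma spr_less_one_H_WW:
  assumes "spr_less_one (H_full P)"
  shows "spr_less_one (H_WW P)"
proof -
  have "H_WW P = (\<lambda>p p'. H_full P (Inr p) (Inr p'))"
    by (simp add: fun_eq_iff H_WW_def)
  then show ?thesis
    using spr_less_one_submatrix[OF assms] by simp
qed

text \<open>Countability of \<open>grid_points\<close> merges the exceptional sets of all grid
  points into one null set, outside of which the results for a fixed realization apply.\<close>

lemma AE_W_eq_Y_total:
  assumes M: "prob_space M" and drifts: "linear_drifts M P \<xi>" and noise: "driving_noise M P \<pi> \<xi>"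
    and t0: "t0 \<noteq> \<infinity>"
    and inf_start: "t0 = -\<infinity> \<Longrightarrow>
      spr_less_one (H_full P) \<and> (\<forall>\<alpha> p. amalgam_norm (real (freq P p)) (bfun P \<alpha> p) < \<infinity>)"
    and har: "linear_har_process M P \<pi> \<xi> t0 N W lam"
    and bounded: "t0 = -\<infinity> \<Longrightarrow> bounded_means M P W lam"
  shows "AE \<omega> in M. \<forall>(p, k)\<in>grid_points P. t0 \<le> ereal k \<longrightarrow>
    0 \<le> W p k \<omega> \<and> ennreal (W p k \<omega>) = Y_total (\<lambda>p k. \<xi> p k \<omega>) (\<lambda>m. N m \<omega>) t0 p k"
proof -
  have "AE \<omega> in M. \<forall>(p, k)\<in>grid_points P. 0 \<le> \<xi> p k \<omega>"
    using drifts unfolding linear_drifts_def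
    by (intro AE_ball_countable' countable_grid_points) (auto simp: case_prod_unfold)
  moreover have "AE \<omega> in M. \<forall>(p, k)\<in>grid_points P. t0 \<le> ereal k \<longrightarrow>
        har_input_converges P t0 (\<lambda>m. N m \<omega>) (\<lambda>p k. W p k \<omega>) (Inr p) k \<and>
        W p k \<omega> = \<xi> p k \<omega> + har_input P t0 (\<lambda>m. N m \<omega>) (\<lambda>p k. W p k \<omega>) (Inr p) k"
    using har unfolding linear_har_process_def by blast
  \<comment> \<open>The condition on \<open>t0\<close> sits inside the almost sure statement, so
    that one elimination serves both kinds of start.\<close>
  moreover have "AE \<omega> in M. t0 = -\<infinity> \<longrightarrow>
      (\<forall>(p, k)\<in>grid_points P. liminf (\<lambda>n. past_bound (\<lambda>p k. W p k \<omega>) (- real n) p k) = 0)"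
  proof (cases "t0 = -\<infinity>")
    case True
    interpret subcritical P
      using inf_start[OF True] by unfold_locales (auto intro: spr_less_one_H_WW)
    have meas: "W q l \<in> borel_measurable M" if "l \<in> grid P q" for q l
      using har that True unfolding linear_har_process_def
      by (intro borel_measurable_history[OF M drifts noise]) (auto simp: grid_points_def)
    define C where "C = (SUP (p, k)\<in>grid_points P. \<integral>\<^sup>+\<omega>. ennreal \<bar>W p k \<omega>\<bar> \<partial>M)"
    have "C < \<infinity>"
      using bounded[OF True] by (simp add: bounded_means_def C_def)
    moreover have "(\<integral>\<^sup>+\<omega>. ennreal \<bar>W q l \<omega>\<bar> \<partial>M) \<le> C" if "l \<in> grid P q" for q l
      unfolding C_def using that by (intro SUP_upper2[of "(q, l)"]) (auto simp: grid_points_def)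
    ultimately have "AE \<omega> in M. liminf (\<lambda>n. past_bound (\<lambda>p k. W p k \<omega>) (- real n) p k) = 0"
      if "k \<in> grid P p" for p k
      using that meas by (intro AE_liminf_past_bound)
    then show ?thesis
      using True unfolding case_prod_unfold
      by (simp, intro AE_ball_countable' countable_grid_points) (auto simp: grid_points_def)
  qed simp
  ultimately show ?thesis
  proof eventually_elim
    case (elim \<omega>)
    interpret har_realization P t0 "\<lambda>m. N m \<omega>" "\<lambda>p k. W p k \<omega>" "\<lambda>p k. \<xi> p k \<omega>"
      using elim inf_start t0
      by unfold_locales (auto simp: grid_points_def intro!: bfun_convergent)
    show ?case
    proof (clarsimp simp: grid_points_def)
      fix p k assume k: "k \<in> grid P p" "t0 \<le> ereal k"
      show "0 \<le> W p k \<omega> \<and> ennreal (W p k \<omega>) = Y_total (\<lambda>p k. \<xi> p k \<omega>) (\<lambda>m. N m \<omega>) t0 p k"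
      proof (cases t0)
        case (real a)
        then show ?thesis
          using k by (intro W_eq_Y_total_finite_start)
      next
        case PInf
        then show ?thesis
          using t0 by simp
      next
        case MInf
        then show ?thesis
          using k elim(3) by (intro W_eq_Y_total_infinite_start) (auto simp: grid_points_def)
      qed
    qed
  qed
qed

end

theorem theorem4p5:
  fixes M :: "'a measure"
    and P :: "('m::finite, 'p::finite) har_params"
    and \<pi> :: "'m \<Rightarrow> 'a \<Rightarrow> (real \<times> real) set"
    and \<xi> :: "'p \<Rightarrow> real \<Rightarrow> 'a \<Rightarrow> real"
    and t0 :: ereal
  assumes "prob_space M"
    and "linear_params P"
    and "linear_drifts M P \<xi>"
    and "driving_noise M P \<pi> \<xi>"
    and "t0 \<noteq> \<infinity>"
    and real_start: "t0 \<noteq> -\<infinity> \<Longrightarrow>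
          (\<forall>\<alpha> m. l1_norm (hfun P \<alpha> (Inl m)) < \<infinity>) \<and>
          (\<forall>m p. l1_norm (hfun P (Inl m) (Inr p)) < \<infinity>) \<and>
          (\<forall>m p. l1_norm (bfun P (Inl m) p) < \<infinity>) \<and>
          (\<forall>p' p. amalgam_norm (real (freq P p)) (hfun P (Inr p') (Inr p)) < \<infinity>) \<and>
          (\<forall>p' p. amalgam_norm (real (freq P p)) (bfun P (Inr p') p) < \<infinity>)"
    and infinite_start: "t0 = -\<infinity> \<Longrightarrow>
          spr_less_one (H_full P) \<and>
          (\<forall>\<alpha> p. amalgam_norm (real (freq P p)) (bfun P \<alpha> p) < \<infinity>) \<and>
          (SUP (p, k)\<in>grid_points P. \<integral>\<^sup>+ \<omega>. ennreal \<bar>\<xi> p k \<omega>\<bar> \<partial>M) < \<infinity>"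
  shows
    "(\<forall>N W lam.
        linear_har_process M P \<pi> \<xi> t0 N W lam \<and>
        (if t0 = -\<infinity> then bounded_means M P W lam else non_explosive M P t0 N W) \<longrightarrow>
        (AE \<omega> in M. \<forall>(p, k)\<in>grid_points P. t0 \<le> ereal k \<longrightarrow>
           ereal (W p k \<omega>) = enn2ereal
             (Y_b P t0 p k + Y_xi P (\<lambda>p' k'. \<xi> p' k' \<omega>) t0 p k +
              (\<Sum>m\<in>UNIV. \<integral>\<^sup>+ s\<in>ico t0 k. Y_pt P m t0 s p k \<partial>count_space (N m \<omega>)))) \<and>
        (\<forall>m. AE (\<omega>, t) in M \<Otimes>\<^sub>M lborel. t0 \<le> ereal t \<longrightarrow>
           ereal (lam m t \<omega>) = enn2ereal
             (immigrant_rate P (\<lambda>p' k'. \<xi> p' k' \<omega>) m t0 t +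
              (\<Sum>m'\<in>UNIV. \<integral>\<^sup>+ s\<in>ico t0 t. cluster_kernel P m m' s t \<partial>count_space (N m' \<omega>))))) \<and>
     (spr_less_one (H_full P) \<longrightarrow> spr_less_one (H_WW P)) \<and>
     (spr_less_one (H_WW P) \<longrightarrow>
        (\<forall>m m0 s.
           (\<integral>\<^sup>+ t\<in>{s<..}. cluster_kernel P m m0 s t \<partial>lborel)
           \<le> l1_norm (hfun P (Inl m) (Inl m0)) +
             (\<Sum>p\<in>UNIV. \<Sum>p'\<in>UNIV.
                of_nat (freq P p) * l1_norm (hfun P (Inl m) (Inr p)) *
                ennreal (matrix_inv (mat 1 - real_matrix (H_WW P)) $ p $ p') *
                amalgam_norm 1 (hfun P (Inr p') (Inl m0)))))"
  proof (intro conjI allI impI)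
  interpret linear_parameters P
    by unfold_locales fact
  fix N :: "'m \<Rightarrow> 'a \<Rightarrow> real set" and W lam
  assume process: "linear_har_process M P \<pi> \<xi> t0 N W lam \<and>
    (if t0 = -\<infinity> then bounded_means M P W lam else non_explosive M P t0 N W)"
  have W: "AE \<omega> in M. \<forall>(p, k)\<in>grid_points P. t0 \<le> ereal k \<longrightarrow>
    0 \<le> W p k \<omega> \<and> ennreal (W p k \<omega>) = Y_total (\<lambda>p k. \<xi> p k \<omega>) (\<lambda>m. N m \<omega>) t0 p k"
    using assms(1,3-5) infinite_start process by (intro AE_W_eq_Y_total) auto
  then show "AE \<omega> in M. \<forall>(p, k)\<in>grid_points P. t0 \<le> ereal k \<longrightarrow>
           ereal (W p k \<omega>) = enn2ereal
             (Y_b P t0 p k + Y_xi P (\<lambda>p' k'. \<xi> p' k' \<omega>) t0 p k +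
              (\<Sum>m\<in>UNIV. \<integral>\<^sup>+ s\<in>ico t0 k. Y_pt P m t0 s p k \<partial>count_space (N m \<omega>)))"
  proof eventually_elim
    case (elim \<omega>)
    then show ?case
      by (auto simp: Y_total_def[symmetric] enn2ereal_ennreal dest!: bspec) (metis enn2ereal_ennreal)
  qed
  fix m
  have "AE (\<omega>, t) in M \<Otimes>\<^sub>M lborel. t0 \<le> ereal t \<longrightarrow>
        har_input_converges P t0 (\<lambda>m'. N m' \<omega>) (\<lambda>p k. W p k \<omega>) (Inl m) t \<and>
        lam m t \<omega> = base P m + har_input P t0 (\<lambda>m'. N m' \<omega>) (\<lambda>p k. W p k \<omega>) (Inl m) t"
    using process unfolding linear_har_process_def by blast
  then show "AE (\<omega>, t) in M \<Otimes>\<^sub>M lborel. t0 \<le> ereal t \<longrightarrow>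
           ereal (lam m t \<omega>) = enn2ereal
             (immigrant_rate P (\<lambda>p' k'. \<xi> p' k' \<omega>) m t0 t +
              (\<Sum>m'\<in>UNIV. \<integral>\<^sup>+ s\<in>ico t0 t. cluster_kernel P m m' s t \<partial>count_space (N m' \<omega>)))"
    using AE_pair_lborel_fst[OF W]
  proof eventually_elim
    case (elim z)
    obtain \<omega> t where z: "z = (\<omega>, t)"
      by (cases z)
    show ?case
      using elim unfolding z prod.case fst_conv
      by (auto intro!: cluster_representation simp: grid_points_def)
  qed
next
  interpret linear_parameters P
    by unfold_locales fact
  show "spr_less_one (H_WW P)" if "spr_less_one (H_full P)"
    using that by (rule spr_less_one_H_WW)
  fix m m0 s
  assume "spr_less_one (H_WW P)"
  then interpret subcritical P
    by unfold_locales
  show "(\<integral>\<^sup>+ t\<in>{s<..}. cluster_kernel P m m0 s t \<partial>lborel)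
           \<le> l1_norm (hfun P (Inl m) (Inl m0)) +
             (\<Sum>p\<in>UNIV. \<Sum>p'\<in>UNIV.
                of_nat (freq P p) * l1_norm (hfun P (Inl m) (Inr p)) *
                ennreal (matrix_inv (mat 1 - real_matrix (H_WW P)) $ p $ p') *
                amalgam_norm 1 (hfun P (Inr p') (Inl m0)))"
    using nn_integral_cluster_kernel_le[of m m0 s] by (simp add: H_inv_def)
qed

end
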